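(* Let $\mathcal{Q}$ be a set of noncommutative polynomials in $\mathbb{C}\langle Z_{i,j}\rangle$, let $\mathbf{m}=(m_1,\ldots,m_k)\in\mathbb{N}^k$, and let $\mathbf{A}=(A_1,\ldots,A_k)\in B(\mathcal{H})^{n_1}\times_c\cdots\times_cB(\mathcal{H})^{n_k}$, $A_i=(A_{i,1},\ldots,A_{i,n_i})$, be such that each $\sum_{\alpha\in\mathbb{F}_{n_i}^+}a_{i,\alpha}A_{i,\alpha}A_{i,\alpha}^*$ is weakly convergent and $q(\mathbf{A})=0$ for any $q\in\mathcal{Q}$. Then the following statements are equivalent. (i) There is a tuple $\mathbf{T}=(T_1,\ldots,T_k)$, $T_i=(T_{i,1},\ldots,T_{i,n_i})$, in the noncommutative variety $\mathcal{V}_{\mathcal{Q}}(\mathcal{H})$ with $\mathbf{\Delta}_{\mathbf{f},\mathbf{T}}^{\mathbf{m}}(I)>0$, and an invertible operator $Y\in B(\mathcal{H})$, such that $A_{i,j}=Y^{-1}T_{i,j}Y$ for all $i\in\{1,\ldots,k\}$ and $j\in\{1,\ldots,n_i\}$. (ii) There exists a positive operator $Q\in B(\mathcal{H})$ such that $\mathbf{\Delta}_{\mathbf{f},\mathbf{A}}^{\mathbf{p}}(Q)\geq0$ for any $\mathbf{p}\in\mathbb{Z}_+^k$ with $\mathbf{p}\leq\mathbf{m}$, and $\mathbf{\Delta}_{\mathbf{f},\mathbf{A}}^{\mathbf{m}}(Q)>0$. (iii) $r_{f_i}(A_{i,1},\ldots,A_{i,n_i})<1$ for each $i\in\{1,\ldots,k\}$.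 (iv) $\lim_{s\to\infty}\|\Phi_{f_i,A_i}^s(I)\|=0$ for each $i\in\{1,\ldots,k\}$. (v) For each $i\in\{1,\ldots,k\}$, the completely positive map $\Phi_{f_i,A_i}$ is power bounded and pure, and there is an invertible positive operator $R\in B(\mathcal{H})$ such that the equation $\mathbf{\Delta}_{\mathbf{f},\mathbf{A}}^{\mathbf{m}}(X)=R$ has a positive solution $X\in B(\mathcal{H})$ such that $\mathbf{\Delta}_{\mathbf{f},\mathbf{A}}^{\mathbf{p}}(X)\geq0$ for any $\mathbf{p}\in\mathbb{Z}_+^k$ with $\mathbf{p}\leq\mathbf{m}$. Moreover, in this case, for any invertible positive operator $R\in B(\mathcal{H})$, the equation $\mathbf{\Delta}_{\mathbf{f},\mathbf{A}}^{\mathbf{m}}(X)=R$ has a unique positive solution, namely $$X:=\sum_{(s_1,\ldots,s_k)\in\mathbb{Z}_+^k}\binom{s_1+m_1-1}{m_1-1}\cdots\binom{s_k+m_k-1}{m_k-1}\Phi_{f_1,A_1}^{s_1}\circ\cdots\circ\Phi_{f_k,A_k}^{s_k}(R),$$ where the convergence is in the uniform (operator norm) topology, and $X$ is an invertible operator.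
   Context: $\mathcal{H}$ is a separable complex Hilbert space; $\mathbb{N}=\{1,2,\ldots\}$, $\mathbb{Z}_+=\{0,1,\ldots\}$; $n_i\in\mathbb{N}$. Order on $\mathbb{Z}_+^k$ is coordinatewise. For self-adjoint $B$, $B>0$ means $B$ is positive and invertible, i.e. $B\ge\gamma I$ for some $\gamma>0$. $\mathbb{F}_{n_i}^+$ is the free monoid on generators $g_1^i,\ldots,g_{n_i}^i$ with identity $g_0^i$; $|\alpha|$ is word length. For an $n_i$-tuple $(X_{i,1},\ldots,X_{i,n_i})$ and $\alpha=g^i_{j_1}\cdots g^i_{j_p}$, $X_{i,\alpha}:=X_{i,j_1}\cdots X_{i,j_p}$, $X_{i,g_0^i}:=I$. $\mathbf{f}=(f_1,\ldots,f_k)$, where each $f_i=\sum_{\alpha\in\mathbb{F}_{n_i}^+}a_{i,\alpha}Z_{i,\alpha}$ is a positive regular free holomorphic function: a formal power series in noncommuting $Z_{i,1},\ldots,Z_{i,n_i}$ with $a_{i,\alpha}\ge0$, $a_{i,g_0^i}=0$, $a_{i,g_j^i}>0$ for $j=1,\ldots,n_i$, and $\limsup_{p\to\infty}(\sum_{|\alpha|=p}|a_{i,\alpha}|^2)^{1/2p}<\infty$. $\mathbb{C}\langle Z_{i,j}\rangle$ is the algebra of polynomials in $Z_{i,j}$ ($1\le i\le k$, $1\le j\le n_i$) where $Z_{s,j}$ and $Z_{t,l}$ commute for $s\neq t$ and are otherwise noncommuting. $B(\mathcal{H})^{n_1}\times_c\cdots\times_cB(\mathcal{H})^{n_k}$ is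 the set of tuples $\mathbf{X}=(X_1,\ldots,X_k)$, $X_i=(X_{i,1},\ldots,X_{i,n_i})$, such that for $s\ne t$ the entries of $X_s$ commute with those of $X_t$. $\Phi_{f_i,X_i}$ is well-defined if $\sum_\alpha a_{i,\alpha}X_{i,\alpha}X_{i,\alpha}^*$ converges in the weak operator topology (WOT); then $\Phi_{f_i,X_i}(Y):=\sum_\alpha a_{i,\alpha}X_{i,\alpha}YX_{i,\alpha}^*$ (WOT). $\mathbf{\Delta}_{\mathbf{f},\mathbf{X}}^{\mathbf{p}}:=(id-\Phi_{f_1,X_1})^{p_1}\circ\cdots\circ(id-\Phi_{f_k,X_k})^{p_k}$. $\mathbf{D}_{\mathbf{f}}^{\mathbf{m}}(\mathcal{H})$ is the set of $\mathbf{X}\in B(\mathcal{H})^{n_1}\times_c\cdots\times_cB(\mathcal{H})^{n_k}$ with $\Phi_{f_i,X_i}$ well-defined and $\mathbf{\Delta}_{\mathbf{f},\mathbf{X}}^{\mathbf{p}}(I)\ge0$ for $0\le\mathbf{p}\le\mathbf{m}$. $\mathcal{V}_{\mathcal{Q}}(\mathcal{H}):=\{\mathbf{X}\in\mathbf{D}_{\mathbf{f}}^{\mathbf{m}}(\mathcal{H}):g(\mathbf{X})=0\ \forall g\in\mathcal{Q}\}$. The joint spectral radius is $r_{f_i}(A_i):=\lim_{s\to\infty}\|\Phi_{f_i,A_i}^s(I)\|^{1/2s}$. A linear map $\varphi$ on $B(\mathcal{H})$ is power bounded if $\sup_s\|\varphi^s\|<\infty$; a positive linear map is pure if $\varphi^s(I)\to0$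 weakly as $s\to\infty$. *)

theory Defs
  imports "HOL-Analysis.Analysis" "HOL-Library.Poly_Mapping"
begin

section \<open>Complex Hilbert spaces\<close>

class complex_vector = real_vector +
  fixes scaleC :: "complex \<Rightarrow> 'a \<Rightarrow> 'a" (infixr "*\<^sub>C" 75)
  assumes scaleC_add_right: "c *\<^sub>C (x + y) = c *\<^sub>C x + c *\<^sub>C y"
    and scaleC_add_left: "(c + d) *\<^sub>C x = c *\<^sub>C x + d *\<^sub>C x"
    and scaleC_scaleC: "c *\<^sub>C (d *\<^sub>C x) = (c * d) *\<^sub>C x"
    and scaleC_one: "1 *\<^sub>C x = x"
    and scaleR_scaleC: "r *\<^sub>R x = complex_of_real r *\<^sub>C x"

text \<open>The inner product is linear in its first argument. The class \<^class>\<open>banach\<close> contributes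
  completeness with respect to the norm, which is the one induced by the inner product.\<close>

class complex_hilbert = complex_vector + banach +
  fixes cinner :: "'a \<Rightarrow> 'a \<Rightarrow> complex"
  assumes cinner_commute: "cinner x y = cnj (cinner y x)"
    and cinner_add_left: "cinner (x + y) z = cinner x z + cinner y z"
    and cinner_scaleC_left: "cinner (c *\<^sub>C x) y = c * cinner x y"
    and cinner_ge_zero: "0 \<le> Re (cinner x x)"
    and cinner_eq_zero_iff: "cinner x x = 0 \<longleftrightarrow> x = 0"
    and norm_eq_sqrt_cinner: "norm x = sqrt (Re (cinner x x))"

lemma cinner_scaleC_right: "cinner x (c *\<^sub>C y) = cnj c * cinner x y"
  for x y :: "'a::complex_hilbert"
  by (metis cinner_commute cinner_scaleC_left complex_cnj_mult)

lemma norm_scaleC: "norm (c *\<^sub>C x) = cmod c * norm x"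
  for x :: "'a::complex_hilbert"
proof -
  have "cinner (c *\<^sub>C x) (c *\<^sub>C x) = complex_of_real ((cmod c)\<^sup>2) * cinner x x"
    by (simp add: cinner_scaleC_left cinner_scaleC_right complex_norm_square mult.assoc del: of_real_power)
  then have "Re (cinner (c *\<^sub>C x) (c *\<^sub>C x)) = (cmod c)\<^sup>2 * Re (cinner x x)"
    by (simp only: Re_complex_of_real Im_complex_of_real times_complex.sel)
  then show ?thesis
    by (simp add: norm_eq_sqrt_cinner real_sqrt_mult)
qed

lemma bounded_linear_scaleC: "bounded_linear (\<lambda>x::'a::complex_hilbert. c *\<^sub>C x)"
  by (rule bounded_linear_intro[where K = "cmod c"])
    (simp_all add: scaleC_add_right scaleR_scaleC scaleC_scaleC norm_scaleC mult.commute)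


section \<open>The algebra of bounded operators\<close>

definition bounded_clinear :: "('a::complex_hilbert \<Rightarrow> 'a) \<Rightarrow> bool" where
  "bounded_clinear T \<longleftrightarrow> bounded_linear T \<and> (\<forall>c x. T (c *\<^sub>C x) = c *\<^sub>C T x)"

typedef (overloaded) 'a bop = "{T :: 'a::complex_hilbert \<Rightarrow> 'a. bounded_clinear T}"
  morphisms app Bop
  by (rule exI[of _ "\<lambda>x. x"]) (simp add: bounded_clinear_def bounded_linear_ident)

setup_lifting type_definition_bop

lemma bop_eqI: "(\<And>x. app S x = app T x) \<Longrightarrow> S = T"
  by transfer auto

instantiation bop :: (complex_hilbert) real_normed_algebra
begin

lift_definition norm_bop :: "'a bop \<Rightarrow> real" is onorm .

lift_definition zero_bop :: "'a bop" is "\<lambda>x. 0"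
  by (simp add: bounded_clinear_def linear_simps[OF bounded_linear_scaleC])

lift_definition plus_bop :: "'a bop \<Rightarrow> 'a bop \<Rightarrow> 'a bop" is "\<lambda>S T x. S x + T x"
  by (simp add: bounded_clinear_def bounded_linear_add scaleC_add_right)

lift_definition uminus_bop :: "'a bop \<Rightarrow> 'a bop" is "\<lambda>T x. - T x"
  by (simp add: bounded_clinear_def bounded_linear_minus linear_simps[OF bounded_linear_scaleC])

lift_definition minus_bop :: "'a bop \<Rightarrow> 'a bop \<Rightarrow> 'a bop" is "\<lambda>S T x. S x - T x"
  by (simp add: bounded_clinear_def bounded_linear_sub linear_simps[OF bounded_linear_scaleC])

lift_definition scaleR_bop :: "real \<Rightarrow> 'a bop \<Rightarrow> 'a bop" is "\<lambda>r T x. r *\<^sub>R T x"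
  by (simp add: bounded_clinear_def scaleR_scaleC scaleC_scaleC mult.commute
      bounded_linear_compose[OF bounded_linear_scaleC])

lift_definition times_bop :: "'a bop \<Rightarrow> 'a bop \<Rightarrow> 'a bop" is "\<lambda>S T x. S (T x)"
  by (simp add: bounded_clinear_def bounded_linear_compose)

definition dist_bop :: "'a bop \<Rightarrow> 'a bop \<Rightarrow> real"
  where "dist_bop S T = norm (S - T)"

definition sgn_bop :: "'a bop \<Rightarrow> 'a bop"
  where "sgn_bop T = scaleR (inverse (norm T)) T"

definition uniformity_bop :: "('a bop \<times> 'a bop) filter"
  where [code del]: "uniformity_bop = (INF e\<in>{0 <..}. principal {(S, T). dist S T < e})"

definition open_bop :: "'a bop set \<Rightarrow> bool"
  where [code del]: "open_bop U = (\<forall>S\<in>U. \<forall>\<^sub>F (S', T) in uniformity. S' = S \<longrightarrow> T \<in> U)"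

instance
proof
  fix S T V :: "'a bop" and r s :: real and U :: "'a bop set"
  show "dist S T = norm (S - T)" by (rule dist_bop_def)
  show "sgn T = scaleR (inverse (norm T)) T" by (rule sgn_bop_def)
  show "(uniformity :: ('a bop \<times> 'a bop) filter) = (INF e\<in>{0 <..}. principal {(S, T). dist S T < e})"
    by (rule uniformity_bop_def)
  show "open U = (\<forall>S\<in>U. \<forall>\<^sub>F (S', T) in uniformity. S' = S \<longrightarrow> T \<in> U)"
    by (rule open_bop_def)
  show "S + T + V = S + (T + V)" by transfer (simp add: algebra_simps)
  show "S + T = T + S" by transfer (simp add: algebra_simps)
  show "0 + T = T" by transfer simp
  show "- T + T = 0" by transfer simp
  show "S - T = S + - T" by transfer simp
  show "r *\<^sub>R (S + T) = r *\<^sub>R S + r *\<^sub>R T" by transfer (simp add: algebra_simps)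
  show "(r + s) *\<^sub>R T = r *\<^sub>R T + s *\<^sub>R T" by transfer (simp add: algebra_simps)
  show "r *\<^sub>R s *\<^sub>R T = (r * s) *\<^sub>R T" by transfer simp
  show "1 *\<^sub>R T = T" by transfer simp
  show "S * T * V = S * (T * V)" by transfer simp
  show "(S + T) * V = S * V + T * V" by transfer simp
  show "S * (T + V) = S * T + S * V"
    by transfer (simp add: bounded_clinear_def linear_simps)
  show "(r *\<^sub>R S) * T = r *\<^sub>R (S * T)" by transfer simp
  show "S * (r *\<^sub>R T) = r *\<^sub>R (S * T)"
    by transfer (simp add: bounded_clinear_def linear_simps)
  show "norm T = 0 \<longleftrightarrow> T = 0"
    by transfer (auto simp: bounded_clinear_def onorm_eq_0)
  show "norm (S + T) \<le> norm S + norm T"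
    by transfer (simp add: bounded_clinear_def onorm_triangle)
  show "norm (r *\<^sub>R T) = \<bar>r\<bar> * norm T"
    by transfer (simp add: bounded_clinear_def onorm_scaleR)
  show "norm (S * T) \<le> norm S * norm T"
    by transfer (simp add: bounded_clinear_def onorm_compose[unfolded comp_def])
qed

end

instantiation bop :: (complex_hilbert) monoid_mult
begin

lift_definition one_bop :: "'a bop" is "\<lambda>x. x"
  by (simp add: bounded_clinear_def bounded_linear_ident)

instance
proof
  fix T :: "'a bop"
  show "1 * T = T" by transfer simp
  show "T * 1 = T" by transfer simp
qed

end

instantiation bop :: (complex_hilbert) complex_vector
begin

lift_definition scaleC_bop :: "complex \<Rightarrow> 'a bop \<Rightarrow> 'a bop" is "\<lambda>c T x. c *\<^sub>C T x"
  by (simp add: bounded_clinear_def scaleC_scaleC mult.commute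
      bounded_linear_compose[OF bounded_linear_scaleC])

instance
proof
  fix S T :: "'a bop" and c d :: complex and r :: real
  show "c *\<^sub>C (S + T) = c *\<^sub>C S + c *\<^sub>C T" by transfer (simp add: scaleC_add_right)
  show "(c + d) *\<^sub>C T = c *\<^sub>C T + d *\<^sub>C T" by transfer (simp add: scaleC_add_left)
  show "c *\<^sub>C d *\<^sub>C T = (c * d) *\<^sub>C T" by transfer (simp add: scaleC_scaleC)
  show "1 *\<^sub>C T = T" by transfer (simp add: scaleC_one)
  show "r *\<^sub>R T = complex_of_real r *\<^sub>C T" by transfer (simp add: scaleR_scaleC)
qed

end

definition adj :: "'h::complex_hilbert bop \<Rightarrow> 'h bop" where
  "adj T = (THE S. \<forall>x y. cinner (app T x) y = cinner x (app S y))"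

definition positive_op :: "'h::complex_hilbert bop \<Rightarrow> bool" where
  "positive_op T \<longleftrightarrow> (\<forall>x. cinner (app T x) x \<in> \<real> \<and> 0 \<le> Re (cinner (app T x) x))"

definition invertible_op :: "'h::complex_hilbert bop \<Rightarrow> bool" where
  "invertible_op T \<longleftrightarrow> (\<exists>S. S * T = 1 \<and> T * S = 1)"

definition strictly_positive_op :: "'h::complex_hilbert bop \<Rightarrow> bool" where
  "strictly_positive_op T \<longleftrightarrow> positive_op T \<and> invertible_op T"

text \<open>Convergence of a family of operators in the weak operator topology; for the series used below,
  unconditional convergence and convergence of the partial sums over word length coincide.\<close>

definition has_wot_sum :: "('i \<Rightarrow> 'h::complex_hilbert bop) \<Rightarrow> 'h bop \<Rightarrow> 'i set \<Rightarrow> bool" where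
  "has_wot_sum F S I \<longleftrightarrow> (\<forall>x y. ((\<lambda>i. cinner (app (F i) x) y) has_sum cinner (app S x) y) I)"


section \<open>Free holomorphic functions and the maps they induce\<close>

text \<open>The word $g_{j_1} \cdots g_{j_p}$ of the free monoid on $n$ generators is the list
  $[j_1, \ldots, j_p]$ over \<^term>\<open>{1..n}\<close>, and a formal power series is its family of coefficients;
  values on lists outside \<^term>\<open>lists {1..n}\<close> are never used.\<close>

definition positive_regular :: "nat \<Rightarrow> (nat list \<Rightarrow> real) \<Rightarrow> bool" where
  "positive_regular n a \<longleftrightarrow>
     (\<forall>w\<in>lists {1..n}. 0 \<le> a w) \<and> a [] = 0 \<and> (\<forall>j\<in>{1..n}. 0 < a [j]) \<and>
     limsup (\<lambda>p. ereal ((\<Sum>w | w \<in> lists {1..n} \<and> length w = p. \<bar>a w\<bar>\<^sup>2) powr (1 / (2 * real p)))) < \<infinity>"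

definition word_op :: "(nat \<Rightarrow> 'h::complex_hilbert bop) \<Rightarrow> nat list \<Rightarrow> 'h bop" where
  "word_op X w = prod_list (map X w)"

definition Phi_well_defined ::
    "nat \<Rightarrow> (nat list \<Rightarrow> real) \<Rightarrow> (nat \<Rightarrow> 'h::complex_hilbert bop) \<Rightarrow> bool" where
  "Phi_well_defined n a X \<longleftrightarrow>
     (\<exists>S. has_wot_sum (\<lambda>w. a w *\<^sub>R (word_op X w * adj (word_op X w))) S (lists {1..n}))"

definition Phi ::
    "nat \<Rightarrow> (nat list \<Rightarrow> real) \<Rightarrow> (nat \<Rightarrow> 'h::complex_hilbert bop) \<Rightarrow> 'h bop \<Rightarrow> 'h bop" where
  "Phi n a X Y =
     (THE S. has_wot_sum (\<lambda>w. a w *\<^sub>R (word_op X w * Y * adj (word_op X w))) S (lists {1..n}))"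

definition joint_spectral_radius ::
    "nat \<Rightarrow> (nat list \<Rightarrow> real) \<Rightarrow> (nat \<Rightarrow> 'h::complex_hilbert bop) \<Rightarrow> real" where
  "joint_spectral_radius n a X = lim (\<lambda>s. norm ((Phi n a X ^^ s) 1) powr (1 / (2 * real s)))"

text \<open>The norm of a power is its operator norm \<^const>\<open>onorm\<close> as a map on the normed space of
  operators, which is meaningful only for bounded maps.\<close>

definition power_bounded :: "('h::complex_hilbert bop \<Rightarrow> 'h bop) \<Rightarrow> bool" where
  "power_bounded \<phi> \<longleftrightarrow>
     (\<forall>s. bounded_linear (\<phi> ^^ s)) \<and> bdd_above (range (\<lambda>s. onorm (\<phi> ^^ s)))"

definition pure :: "('h::complex_hilbert bop \<Rightarrow> 'h bop) \<Rightarrow> bool" where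
  "pure \<phi> \<longleftrightarrow> (\<forall>x y. (\<lambda>s. cinner (app ((\<phi> ^^ s) 1) x) y) \<longlonglongrightarrow> 0)"


section \<open>Polydomains and noncommutative varieties\<close>

text \<open>A tuple $(X_{i,j})$ with $1 \le i \le k$, $1 \le j \le n_i$ is a function of \<open>i\<close> and \<open>j\<close>
  whose values outside that range are irrelevant; likewise for the series $f_i$ (coefficients
  \<open>a i\<close>) and for multi-indices.\<close>

definition commuting_tuple ::
    "nat \<Rightarrow> (nat \<Rightarrow> nat) \<Rightarrow> (nat \<Rightarrow> nat \<Rightarrow> 'h::complex_hilbert bop) \<Rightarrow> bool" where
  "commuting_tuple k n X \<longleftrightarrow>
     (\<forall>s\<in>{1..k}. \<forall>t\<in>{1..k}. s \<noteq> t \<longrightarrow>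
        (\<forall>j\<in>{1..n s}. \<forall>l\<in>{1..n t}. X s j * X t l = X t l * X s j))"

definition multi_le :: "nat \<Rightarrow> (nat \<Rightarrow> nat) \<Rightarrow> (nat \<Rightarrow> nat) \<Rightarrow> bool" where
  "multi_le k p m \<longleftrightarrow> (\<forall>i\<in>{1..k}. p i \<le> m i)"

definition comp_upto :: "nat \<Rightarrow> (nat \<Rightarrow> 'b \<Rightarrow> 'b) \<Rightarrow> 'b \<Rightarrow> 'b" where
  "comp_upto k F = foldr (\<circ>) (map F [1..<Suc k]) id"

definition Delta ::
    "nat \<Rightarrow> (nat \<Rightarrow> nat) \<Rightarrow> (nat \<Rightarrow> nat list \<Rightarrow> real) \<Rightarrow> (nat \<Rightarrow> nat \<Rightarrow> 'h::complex_hilbert bop)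
      \<Rightarrow> (nat \<Rightarrow> nat) \<Rightarrow> 'h bop \<Rightarrow> 'h bop" where
  "Delta k n a X p = comp_upto k (\<lambda>i. (\<lambda>Y. Y - Phi (n i) (a i) (X i) Y) ^^ p i)"

definition polydomain ::
    "nat \<Rightarrow> (nat \<Rightarrow> nat) \<Rightarrow> (nat \<Rightarrow> nat list \<Rightarrow> real) \<Rightarrow> (nat \<Rightarrow> nat)
      \<Rightarrow> (nat \<Rightarrow> nat \<Rightarrow> 'h::complex_hilbert bop) set" where
  "polydomain k n a m =
     {X. commuting_tuple k n X \<and> (\<forall>i\<in>{1..k}. Phi_well_defined (n i) (a i) (X i)) \<and>
         (\<forall>p. multi_le k p m \<longrightarrow> positive_op (Delta k n a X p 1))}"

text \<open>Since $Z_{s,j}$ and $Z_{t,l}$ commute for $s \ne t$, the monomials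
  $Z_{1,\alpha_1} \cdots Z_{k,\alpha_k}$ with $\alpha_i$ a word over \<^term>\<open>{1..n i}\<close> form a basis of
  the polynomial algebra. Such a monomial is the function $i \mapsto \alpha_i$, padded with empty
  words, and a polynomial is a finitely supported family of coefficients.\<close>

type_synonym nc_poly = "(nat \<Rightarrow> nat list) \<Rightarrow>\<^sub>0 complex"

definition monomials :: "nat \<Rightarrow> (nat \<Rightarrow> nat) \<Rightarrow> (nat \<Rightarrow> nat list) set" where
  "monomials k n = {w. (\<forall>i\<in>{1..k}. w i \<in> lists {1..n i}) \<and> (\<forall>i. i \<notin> {1..k} \<longrightarrow> w i = [])}"

definition nc_polys :: "nat \<Rightarrow> (nat \<Rightarrow> nat) \<Rightarrow> nc_poly set" where
  "nc_polys k n = {q. Poly_Mapping.keys q \<subseteq> monomials k n}"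

definition eval_poly :: "nat \<Rightarrow> nc_poly \<Rightarrow> (nat \<Rightarrow> nat \<Rightarrow> 'h::complex_hilbert bop) \<Rightarrow> 'h bop" where
  "eval_poly k q X =
     (\<Sum>w\<in>Poly_Mapping.keys q.
        Poly_Mapping.lookup q w *\<^sub>C prod_list (map (\<lambda>i. word_op (X i) (w i)) [1..<Suc k]))"

definition nc_variety ::
    "nat \<Rightarrow> (nat \<Rightarrow> nat) \<Rightarrow> (nat \<Rightarrow> nat list \<Rightarrow> real) \<Rightarrow> (nat \<Rightarrow> nat) \<Rightarrow> nc_poly set
      \<Rightarrow> (nat \<Rightarrow> nat \<Rightarrow> 'h::complex_hilbert bop) set" where
  "nc_variety k n a m Q = {X \<in> polydomain k n a m. \<forall>q\<in>Q. eval_poly k q X = 0}"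

end

theory Submission
  imports Defs
begin

text \<open>All five conditions are compared with geometric decay of \<open>\<parallel>\<Phi>\<^sub>i\<^sup>s(I)\<parallel>\<close>. This sequence is
  submultiplicative, so by Fekete's argument the limit defining the joint spectral radius exists, and
  it is below 1, or the norms tend to 0, exactly when they decay geometrically. If \<open>Q\<close> is as in (ii),
  then \<open>\<Delta>\<^sup>p(Q)\<close> decreases in \<open>p\<close>, so \<open>Q - \<Phi>\<^sub>i(Q) \<ge> \<Delta>\<^sup>m(Q) \<ge> \<gamma> I\<close>; hence \<open>\<Phi>\<^sub>i(Q) \<le> r Q\<close> with \<open>r < 1\<close>,
  and \<open>Q \<ge> \<gamma> I\<close> transfers the decay to \<open>\<Phi>\<^sub>i\<^sup>s(I)\<close>. Conversely, under decay the binomial series sum to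
  inverses of \<open>(id - \<Phi>\<^sub>i)\<^sup>m\<close> that preserve positivity, and their composition solves the equation.
  For (i), \<open>Q = Z\<^sup>2\<close> with \<open>Z\<close> self-adjoint is matched with the similarity \<open>T = Z\<^sup>-\<^sup>1 A Z\<close>, under
  which \<open>\<Delta>\<^sub>A\<^sup>p(Q)\<close> becomes \<open>Z \<Delta>\<^sub>T\<^sup>p(I) Z\<close>.\<close>

section \<open>Hilbert space geometry\<close>

text \<open>\<open>Phi\<close> and \<open>adj\<close> are definite descriptions, so each value has
  to be exhibited as the operator of a bounded sesquilinear form; this is why a Riesz theorem comes
  so early. Weak convergence is assumed only at the identity, and the nonnegative coefficients turn
  that one series into a majorant for the series at every operator. The norm of Phi^s(Y) for
  arbitrary Y must be controlled by Phi^s(I) alone. This is the usual service of complete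
  positivity; a scalar domination relation that is stable under Phi takes its place. Decay is kept
  as a geometric rate because the solution series carries binomial weights that grow polynomially in
  s. Monotonicity in (ii) comes from Delta^p - Delta^(p + e_i) = Phi_i(Delta^p), where e_i is the
  i-th unit multi-index. The solution X in (v) is itself the Q of (ii). The root Z of Q comes from
  writing Q = M (1 - E) with norm E < 1 and using the binomial series of (1 - x)^(1/2), in place of
  a functional calculus.\<close>

lemma cinner_add_right: "cinner x (y + z) = cinner x y + cinner x z"
  for x :: "'a::complex_hilbert"
  by (metis cinner_add_left cinner_commute complex_cnj_add)

lemma cinner_zero_left [simp]: "cinner 0 x = 0" for x :: "'a::complex_hilbert"
  using cinner_add_left[of 0 0 x] by simp

lemma cinner_zero_right [simp]: "cinner x 0 = 0" for x :: "'a::complex_hilbert"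
  using cinner_add_right[of x 0 0] by simp

lemma cinner_minus_left: "cinner (- x) y = - cinner x y" for x :: "'a::complex_hilbert"
  using cinner_add_left[of x "- x" y] by (simp add: eq_neg_iff_add_eq_0 add.commute)

lemma cinner_minus_right: "cinner x (- y) = - cinner x y" for x :: "'a::complex_hilbert"
  using cinner_add_right[of x y "- y"] by (simp add: eq_neg_iff_add_eq_0 add.commute)

lemma cinner_diff_left: "cinner (x - y) z = cinner x z - cinner y z" for x :: "'a::complex_hilbert"
  using cinner_add_left[of x "- y" z] by (simp add: cinner_minus_left)

lemma cinner_diff_right: "cinner x (y - z) = cinner x y - cinner x z" for x :: "'a::complex_hilbert"
  using cinner_add_right[of x y "- z"] by (simp add: cinner_minus_right)

lemma cinner_scaleR_left: "cinner (r *\<^sub>R x) y = of_real r * cinner x y" for x :: "'a::complex_hilbert"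
  by (simp add: scaleR_scaleC cinner_scaleC_left)

lemma cinner_scaleR_right: "cinner x (r *\<^sub>R y) = of_real r * cinner x y" for x :: "'a::complex_hilbert"
  by (simp add: scaleR_scaleC cinner_scaleC_right)

lemmas cinner_simps = cinner_add_left cinner_add_right cinner_diff_left cinner_diff_right
  cinner_minus_left cinner_minus_right cinner_scaleC_left cinner_scaleC_right
  cinner_scaleR_left cinner_scaleR_right

lemma cinner_self: "cinner x x = of_real ((norm x)\<^sup>2)" for x :: "'a::complex_hilbert"
  using cinner_commute[of x x] cinner_ge_zero[of x]
  by (simp add: complex_eq_iff norm_eq_sqrt_cinner)

lemma Re_cinner_commute: "Re (cinner y x) = Re (cinner x y)" for x :: "'a::complex_hilbert"
  by (subst cinner_commute) simp

lemma cmod_cinner_commute: "cmod (cinner y x) = cmod (cinner x y)" for x :: "'a::complex_hilbert"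
  by (subst cinner_commute) simp

lemma norm_add_sq: "(norm (x + y))\<^sup>2 = (norm x)\<^sup>2 + 2 * Re (cinner x y) + (norm y)\<^sup>2"
  for x :: "'a::complex_hilbert"
proof -
  have "of_real ((norm (x + y))\<^sup>2) = cinner (x + y) (x + y)" by (simp only: cinner_self)
  also have "\<dots> = cinner x x + cinner x y + cinner y x + cinner y y"
    by (simp add: cinner_simps)
  finally have "Re (of_real ((norm (x + y))\<^sup>2)) = Re (cinner x x + cinner x y + cinner y x + cinner y y)"
    by (rule arg_cong)
  then show ?thesis by (simp add: cinner_self Re_cinner_commute[of y x] del: of_real_power)
qed

lemma norm_diff_sq: "(norm (x - y))\<^sup>2 = (norm x)\<^sup>2 - 2 * Re (cinner x y) + (norm y)\<^sup>2"
  for x :: "'a::complex_hilbert"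
  using norm_add_sq[of x "- y"] by (simp add: cinner_minus_right)

lemma unimodular_rotate: obtains c where "cmod c = 1" "c * z = of_real (cmod z)"
proof (cases "z = 0")
  case True then show ?thesis using that[of 1] by simp
next
  case False
  show ?thesis
  proof (rule that[of "cnj z / of_real (cmod z)"])
    show "cmod (cnj z / of_real (cmod z)) = 1" using False by (simp add: norm_divide)
    show "cnj z / of_real (cmod z) * z = of_real (cmod z)"
      using False by (simp add: field_simps complex_norm_square[symmetric] power2_eq_square)
  qed
qed

text \<open>Expand the square of the norm of c x - y, where the phase c makes c <x, y> nonnegative.
  The additive form of Cauchy-Schwarz is stated because it can be summed term by term.\<close>

lemma cmod_cinner_le_half: "cmod (cinner x y) \<le> ((norm x)\<^sup>2 + (norm y)\<^sup>2) / 2"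
  for x :: "'a::complex_hilbert"
proof -
  obtain c where c: "cmod c = 1" "c * cinner x y = of_real (cmod (cinner x y))"
    by (rule unimodular_rotate)
  have "0 \<le> (norm (c *\<^sub>C x - y))\<^sup>2" by simp
  also have "\<dots> = (norm x)\<^sup>2 - 2 * cmod (cinner x y) + (norm y)\<^sup>2"
    by (simp add: norm_diff_sq norm_scaleC c cinner_scaleC_left)
  finally show ?thesis by simp
qed

text \<open>The estimate on the diagonal scale upgrades to the bilinear one by replacing \<open>x\<close>, \<open>y\<close>
  with \<open>t x\<close>, \<open>y / t\<close>.\<close>

lemma quadratic_to_bilinear_bound:
  fixes B :: "'a::real_normed_vector \<Rightarrow> 'a \<Rightarrow> 'b::real_normed_vector"
  assumes scale: "\<And>r s x y. B (r *\<^sub>R x) (s *\<^sub>R y) = (r * s) *\<^sub>R B x y"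
    and bound: "\<And>x y. norm (B x y) \<le> K * ((norm x)\<^sup>2 + (norm y)\<^sup>2) / 2"
  shows "norm (B x y) \<le> K * norm x * norm y"
proof (cases "x = 0 \<or> y = 0")
  case True
  then show ?thesis using scale[of 0 x 1 y] scale[of 1 x 0 y] by auto
next
  case False
  then have "norm (B (inverse (norm x) *\<^sub>R x) (inverse (norm y) *\<^sub>R y)) \<le> K"
    using bound[of "inverse (norm x) *\<^sub>R x" "inverse (norm y) *\<^sub>R y"] by simp
  then show ?thesis using False by (simp add: scale abs_mult field_simps)
qed

lemma cinner_Cauchy_Schwarz: "cmod (cinner x y) \<le> norm x * norm y" for x :: "'a::complex_hilbert"
proof -
  have "cmod (cinner x y) \<le> 1 * norm x * norm y"
    by (rule quadratic_to_bilinear_bound)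
      (use cmod_cinner_le_half in \<open>simp_all add: cinner_scaleR_left cinner_scaleR_right scaleR_conv_of_real\<close>)
  then show ?thesis by simp
qed

lemma bounded_linear_cinner_left: "bounded_linear (\<lambda>x. cinner x y)"
  for y :: "'a::complex_hilbert"
  by (rule bounded_linear_intro[where K = "norm y"])
    (simp_all add: cinner_simps scaleR_conv_of_real cinner_Cauchy_Schwarz)

lemma bounded_linear_cinner_right: "bounded_linear (\<lambda>x. cinner y x)"
  for y :: "'a::complex_hilbert"
  by (rule bounded_linear_intro[where K = "norm y"])
    (simp_all add: cinner_simps scaleR_conv_of_real cinner_Cauchy_Schwarz mult.commute[of _ "norm y"])

lemma cinner_eqI: "(\<And>y. cinner x y = cinner x' y) \<Longrightarrow> x = x'" for x :: "'a::complex_hilbert"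
  by (metis cinner_diff_left cinner_eq_zero_iff eq_iff_diff_eq_0)

text \<open>Variational proof: the representing vector minimizes \<open>J\<close>, and the vanishing
  first variation at the minimum is the identity sought.\<close>

lemma Riesz_representation:
  fixes f :: "'a::complex_hilbert \<Rightarrow> complex"
  assumes add: "\<And>x y. f (x + y) = f x + f y" and scale: "\<And>c x. f (c *\<^sub>C x) = c * f x"
    and bound: "\<And>x. cmod (f x) \<le> K * norm x"
  obtains z where "\<And>x. f x = cinner x z"
proof -
  define J where "J y = (norm y)\<^sup>2 - 2 * Re (f y)" for y
  have scaleR: "f (r *\<^sub>R x) = r * f x" for r x by (simp add: scaleR_scaleC scale)
  have blf: "bounded_linear f"
    by (rule bounded_linear_intro[where K = K])
      (simp_all add: add scaleR scaleR_conv_of_real bound mult.commute[of _ K])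
  have lower: "- K\<^sup>2 \<le> J y" for y
  proof -
    have "Re (f y) \<le> K * norm y" using complex_Re_le_cmod bound order_trans by blast
    moreover have "0 \<le> (norm y - K)\<^sup>2" by simp
    ultimately show ?thesis unfolding J_def power2_diff by (simp add: mult.commute)
  qed
  have bdd: "bdd_below (range J)" using lower by (auto intro!: bdd_belowI)
  define d where "d = (INF y. J y)"
  have d_le: "d \<le> J y" for y unfolding d_def by (rule cINF_lower[OF bdd]) simp
  \<comment> \<open>The parallelogram law at the midpoint \<open>w\<close>: two near-minimizers of
    \<open>J\<close> are close to each other, so a minimizing sequence is Cauchy.\<close>
  have par: "(norm (y - z))\<^sup>2 \<le> 2 * J y + 2 * J z - 4 * d" for y z
  proof -
    define w where "w = (1/2) *\<^sub>R (y + z)"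
    have nw: "(norm w)\<^sup>2 = ((norm y)\<^sup>2 + 2 * Re (cinner y z) + (norm z)\<^sup>2) / 4"
      by (simp only: w_def norm_scaleR power_mult_distrib norm_add_sq) (simp add: power2_eq_square)
    have fw: "Re (f w) = (Re (f y) + Re (f z)) / 2"
      by (simp add: w_def scaleR add del: scaleR_half_double)
    have "J y + J z - 2 * J w = (norm (y - z))\<^sup>2 / 2"
      unfolding J_def nw fw norm_diff_sq by (simp add: field_simps)
    then show ?thesis using d_le[of w] by linarith
  qed
  have "\<exists>y. J y < d + 1 / real (Suc n)" for n
    using cInf_lessD[of "range J" "d + 1 / real (Suc n)"] unfolding d_def by auto
  then obtain y where y: "\<And>n. J (y n) < d + 1 / real (Suc n)" by metis
  have "Cauchy y"
  proof (rule metric_CauchyI)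
    fix e :: real assume e: "0 < e"
    then obtain N where N: "1 / real (Suc N) < e\<^sup>2 / 4" using nat_approx_posE[of "e\<^sup>2/4"] by auto
    show "\<exists>M. \<forall>p\<ge>M. \<forall>q\<ge>M. dist (y p) (y q) < e"
    proof (intro exI allI impI)
      fix p q assume "N \<le> p" "N \<le> q"
      then have "1 / real (Suc p) \<le> 1 / real (Suc N)" "1 / real (Suc q) \<le> 1 / real (Suc N)"
        by (simp_all add: frac_le)
      then have "(norm (y p - y q))\<^sup>2 < e\<^sup>2"
        using par[of "y p" "y q"] y[of p] y[of q] N by linarith
      then show "dist (y p) (y q) < e"
        using e by (simp add: dist_norm power_less_imp_less_base)
    qed
  qed
  then obtain z where z: "y \<longlonglongrightarrow> z" using Cauchy_convergent convergent_def by blast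
  have "(\<lambda>n. J (y n)) \<longlonglongrightarrow> J z"
    unfolding J_def by (intro tendsto_intros z bounded_linear.tendsto[OF blf])
  moreover have "(\<lambda>n. d + 1 / real (Suc n)) \<longlonglongrightarrow> d + 0"
    by (intro tendsto_intros LIMSEQ_Suc[OF lim_1_over_n])
  ultimately have "J z \<le> d + 0"
    by (rule LIMSEQ_le) (use y less_imp_le in blast)
  then have Jz: "J z \<le> J w" for w using d_le[of w] by simp
  have Re_eq: "Re (f w) = Re (cinner w z)" for w
  proof -
    define b where "b = Re (cinner w z) - Re (f w)"
    have q: "0 \<le> 2 * t * b + t\<^sup>2 * (norm w)\<^sup>2" for t
    proof -
      have "J (z + t *\<^sub>R w) - J z = 2 * t * b + t\<^sup>2 * (norm w)\<^sup>2"
        unfolding J_def b_def norm_add_sq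
        by (simp add: add scaleR cinner_simps power_mult_distrib Re_cinner_commute[of w z] algebra_simps)
      then show ?thesis using Jz[of "z + t *\<^sub>R w"] by simp
    qed
    \<comment> \<open>The extra 1 keeps \<open>u\<close> positive when w = 0. The step t = - b / u
      makes the quadratic in t negative unless b = 0.\<close>
    define u where "u = (norm w)\<^sup>2 + 1"
    have u: "0 < u" unfolding u_def by (simp add: add_nonneg_pos)
    have "0 \<le> 2 * (- b / u) * b + (- b / u)\<^sup>2 * (norm w)\<^sup>2" by (rule q)
    also have "\<dots> = - (b\<^sup>2 * (2 * u - (norm w)\<^sup>2) / u\<^sup>2)"
      using u by (simp add: field_simps power2_eq_square)
    finally have "b\<^sup>2 * (2 * u - (norm w)\<^sup>2) / u\<^sup>2 \<le> 0" by simp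
    moreover have "0 < 2 * u - (norm w)\<^sup>2" using u unfolding u_def by simp
    ultimately have "b\<^sup>2 \<le> 0" using u
      by (simp add: divide_le_0_iff mult_le_0_iff)
    then show ?thesis unfolding b_def by simp
  qed
  \<comment> \<open>Replacing w by i w turns the identity for real parts into the one for imaginary
    parts.\<close>
  have "f w = cinner w z" for w
    using Re_eq[of w] Re_eq[of "\<i> *\<^sub>C w"] by (simp add: scale cinner_scaleC_left complex_eq_iff)
  then show ?thesis by (rule that)
qed

section \<open>Positive operators\<close>

lemma bounded_linear_app: "bounded_linear (app T)"
  using app[of T] by (simp add: bounded_clinear_def)

lemma app_add: "app T (x + y) = app T x + app T y"
  by (rule linear_add[OF bounded_linear.linear[OF bounded_linear_app]])

lemma app_diff: "app T (x - y) = app T x - app T y"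
  by (rule linear_diff[OF bounded_linear.linear[OF bounded_linear_app]])

lemma app_scaleC: "app T (c *\<^sub>C x) = c *\<^sub>C app T x"
  using app[of T] by (simp add: bounded_clinear_def)

lemma app_scaleR: "app T (r *\<^sub>R x) = r *\<^sub>R app T x"
  by (simp add: scaleR_scaleC app_scaleC)

lemma norm_app_le: "norm (app T x) \<le> norm T * norm x"
  using onorm[OF bounded_linear_app] by (simp add: norm_bop.rep_eq)

lemma norm_bop_bound: "0 \<le> K \<Longrightarrow> (\<And>x. norm (app T x) \<le> K * norm x) \<Longrightarrow> norm T \<le> K"
  by (simp add: norm_bop.rep_eq onorm_bound)

lemmas app_simps [simp] = zero_bop.rep_eq plus_bop.rep_eq uminus_bop.rep_eq minus_bop.rep_eq
  scaleR_bop.rep_eq times_bop.rep_eq one_bop.rep_eq scaleC_bop.rep_eq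

lemma bounded_linear_app_left: "bounded_linear (\<lambda>T. app T x)" for x :: "'h::complex_hilbert"
  by (rule bounded_linear_intro[where K = "norm x"]) (simp_all add: norm_app_le)

text \<open>Completeness is borrowed from the real bounded operators \<open>blinfun\<close>, which
  carry the same norm; a pointwise limit of complex linear maps is again complex linear.\<close>

instance bop :: (complex_hilbert) banach
proof
  fix X :: "nat \<Rightarrow> 'a bop" assume X: "Cauchy X"
  define B where "B n = Blinfun (app (X n))" for n
  have B: "blinfun_apply (B n) = app (X n)" for n
    unfolding B_def by (rule bounded_linear_Blinfun_apply[OF bounded_linear_app])
  have norm_eq: "norm (X n - X m) = norm (B n - B m)" for n m
    by (simp add: norm_bop.rep_eq norm_blinfun.rep_eq minus_blinfun.rep_eq B)
  have "Cauchy B"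
    using X unfolding Cauchy_def dist_norm norm_eq .
  then obtain L where L: "B \<longlonglongrightarrow> L" using Cauchy_convergent convergent_def by blast
  have pointwise: "(\<lambda>n. app (X n) x) \<longlonglongrightarrow> blinfun_apply L x" for x
    using bounded_linear.tendsto[OF blinfun.bounded_linear_left L] by (simp add: B)
  have "blinfun_apply L (c *\<^sub>C x) = c *\<^sub>C blinfun_apply L x" for c x
  proof (rule LIMSEQ_unique[OF pointwise])
    show "(\<lambda>n. app (X n) (c *\<^sub>C x)) \<longlonglongrightarrow> c *\<^sub>C blinfun_apply L x"
      unfolding app_scaleC by (rule bounded_linear.tendsto[OF bounded_linear_scaleC pointwise])
  qed
  then have "bounded_clinear (blinfun_apply L)"
    by (simp add: bounded_clinear_def blinfun.bounded_linear_right)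
  then have app_L: "app (Bop (blinfun_apply L)) = blinfun_apply L"
    by (simp add: Bop_inverse)
  have "norm (X n - Bop (blinfun_apply L)) = norm (B n - L)" for n
    by (simp add: norm_bop.rep_eq norm_blinfun.rep_eq minus_blinfun.rep_eq B app_L)
  then have "X \<longlonglongrightarrow> Bop (blinfun_apply L)"
    using L unfolding tendsto_iff dist_norm by simp
  then show "convergent X" by (auto simp: convergent_def)
qed

text \<open>The bound is asked in additive form because that is what termwise estimates of a weakly
  convergent series produce.\<close>

lemma sesquilinear_form_op:
  fixes B :: "'h::complex_hilbert \<Rightarrow> 'h \<Rightarrow> complex"
  assumes addl: "\<And>x x' y. B (x + x') y = B x y + B x' y"
    and addr: "\<And>x y y'. B x (y + y') = B x y + B x y'"
    and scalel: "\<And>c x y. B (c *\<^sub>C x) y = c * B x y"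
    and scaler: "\<And>c x y. B x (c *\<^sub>C y) = cnj c * B x y"
    and bound: "\<And>x y. cmod (B x y) \<le> K * ((norm x)\<^sup>2 + (norm y)\<^sup>2) / 2"
  obtains S where "\<And>x y. cinner (app S x) y = B x y"
proof -
  have CS: "cmod (B x y) \<le> K * norm x * norm y" for x y
    by (rule quadratic_to_bilinear_bound[OF _ bound])
      (simp add: scaleR_scaleC scalel scaler scaleR_conv_of_real mult.assoc)
  have "\<exists>z. \<forall>y. B x y = cinner z y" for x
  proof -
    \<comment> \<open>\<open>B x\<close> is conjugate linear in its second argument, so Riesz is
      applied to its conjugate.\<close>
    obtain z where z: "\<And>y. cnj (B x y) = cinner y z"
      by (rule Riesz_representation[of "\<lambda>y. cnj (B x y)" "K * norm x"])
        (simp_all add: addr scaler CS)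
    have "B x y = cinner z y" for y
      using z[of y] cinner_commute[of z y] by (metis complex_cnj_cnj)
    then show ?thesis by blast
  qed
  then obtain S where S: "\<And>x y. cinner (S x) y = B x y" by metis
  have S_add: "S (x + x') = S x + S x'" for x x'
    by (rule cinner_eqI) (simp add: S cinner_add_left addl)
  have S_scale: "S (c *\<^sub>C x) = c *\<^sub>C S x" for c x
    by (rule cinner_eqI) (simp add: S cinner_scaleC_left scalel)
  have S_bound: "norm (S x) \<le> norm x * K" for x
  proof (cases "S x = 0")
    case True
    \<comment> \<open>The sign of \<open>K\<close> has to be recovered: the bound on the diagonal
      forces it as soon as x is nonzero.\<close>
    have "0 \<le> K * norm x * norm x" using CS[of x x] norm_ge_zero order_trans by blast
    then have "0 \<le> norm x * K"
      by (cases "x = 0") (auto simp: zero_le_mult_iff)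
    then show ?thesis using True by simp
  next
    case False
    have "norm (S x) * norm (S x) = cmod (cinner (S x) (S x))"
      by (simp add: cinner_self norm_mult power2_eq_square)
    also have "\<dots> \<le> K * norm x * norm (S x)" unfolding S by (rule CS)
    finally show ?thesis using False by (simp add: mult.commute)
  qed
  have "bounded_linear S"
    by (rule bounded_linear_intro[OF S_add _ S_bound]) (simp add: scaleR_scaleC S_scale)
  then have "app (Bop S) = S" by (simp add: Bop_inverse bounded_clinear_def S_scale)
  then show ?thesis using S that[of "Bop S"] by simp
qed

lemma bop_cinner_eqI:
  "(\<And>x y. cinner (app S x) y = cinner (app T x) y) \<Longrightarrow> S = T" for S :: "'h::complex_hilbert bop"
  by (intro bop_eqI cinner_eqI)

lemma cmod_cinner_app_le: "cmod (cinner (app T x) y) \<le> norm T * ((norm x)\<^sup>2 + (norm y)\<^sup>2) / 2"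
proof -
  have "cmod (cinner (app T x) y) \<le> norm T * norm x * norm y"
    using cinner_Cauchy_Schwarz[of "app T x" y] norm_app_le[of T x]
    by (meson mult_right_mono norm_ge_zero order_trans)
  also have "\<dots> = norm T * (norm x * norm y)" by simp
  also have "\<dots> \<le> norm T * (((norm x)\<^sup>2 + (norm y)\<^sup>2) / 2)"
    using sum_squares_bound[of "norm x" "norm y"] by (intro mult_left_mono) simp_all
  finally show ?thesis by simp
qed

lemma norm_bop_le_quadratic:
  assumes "0 \<le> K"
    and quad: "\<And>x y. cmod (cinner (app T x) y) \<le> K * ((norm x)\<^sup>2 + (norm y)\<^sup>2) / 2"
  shows "norm T \<le> K"
proof -
  have CS: "cmod (cinner (app T x) y) \<le> K * norm x * norm y" for x y
    by (rule quadratic_to_bilinear_bound[OF _ quad])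
      (simp add: app_scaleR cinner_scaleR_left cinner_scaleR_right scaleR_conv_of_real)
  have bound: "norm (app T x) \<le> K * norm x" if "app T x \<noteq> 0" for x
  proof -
    have "norm (app T x) * norm (app T x) = cmod (cinner (app T x) (app T x))"
      by (simp add: cinner_self norm_mult power2_eq_square)
    also have "\<dots> \<le> K * norm x * norm (app T x)" by (rule CS)
    finally show ?thesis using that by simp
  qed
  show ?thesis
    using \<open>0 \<le> K\<close> bound
    by (intro norm_bop_bound) (metis mult_nonneg_nonneg norm_ge_zero norm_zero)+
qed


text \<open>Existence and uniqueness behind the definite description \<open>adj\<close>: the form
  (x, y) \<mapsto> <x, T y> is represented by an operator, and that operator is the adjoint.\<close>

lemma cinner_adj: "cinner (app T x) y = cinner x (app (adj T) y)"
proof -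
  have bound: "cmod (cinner x (app T y)) \<le> norm T * ((norm x)\<^sup>2 + (norm y)\<^sup>2) / 2" for x y
    using cmod_cinner_app_le[of T y x] by (simp add: cmod_cinner_commute[of "app T y" x] add.commute)
  obtain S where S: "\<And>x y. cinner (app S x) y = cinner x (app T y)"
    by (rule sesquilinear_form_op[of "\<lambda>x y. cinner x (app T y)" "norm T"])
      (use bound in \<open>auto simp: app_add app_scaleC cinner_simps\<close>)
  have S': "cinner (app T x) y = cinner x (app S y)" for x y
    using S[of y x] by (metis cinner_commute)
  have "\<forall>x y. cinner (app T x) y = cinner x (app (adj T) y)"
    unfolding adj_def
  proof (rule theI[where a = S], intro allI S')
    fix S2 assume S2: "\<forall>x y. cinner (app T x) y = cinner x (app S2 y)"
    show "S2 = S"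
      by (rule bop_cinner_eqI) (metis S S2 cinner_commute)
  qed
  then show ?thesis by blast
qed

lemma cinner_adj': "cinner (app (adj T) x) y = cinner x (app T y)"
  by (metis cinner_adj cinner_commute)

lemma adj_eqI: "(\<And>x y. cinner (app T x) y = cinner x (app S y)) \<Longrightarrow> adj T = S"
  by (rule bop_cinner_eqI) (metis cinner_adj' cinner_commute)

lemma adj_times: "adj (S * T) = adj T * adj S"
  by (rule adj_eqI) (simp add: cinner_adj)

lemma adj_one [simp]: "adj 1 = 1"
  by (rule adj_eqI) simp

section \<open>Quadratic forms and the operator order\<close>

definition quad :: "'h::complex_hilbert bop \<Rightarrow> 'h \<Rightarrow> real"
  where "quad T x = Re (cinner (app T x) x)"

lemma quad_simps [simp]:
  "quad 0 x = 0" "quad (S + T) x = quad S x + quad T x" "quad (S - T) x = quad S x - quad T x"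
  "quad (r *\<^sub>R T) x = r * quad T x" "quad 1 x = (norm x)\<^sup>2"
  by (simp_all add: quad_def cinner_simps cinner_self del: of_real_power)

lemma positive_op_iff: "positive_op T \<longleftrightarrow> (\<forall>x. cinner (app T x) x = of_real (quad T x) \<and> 0 \<le> quad T x)"
  by (auto simp: positive_op_def quad_def complex_is_Real_iff complex_eq_iff)

lemma quad_nonneg: "positive_op T \<Longrightarrow> 0 \<le> quad T x"
  by (simp add: positive_op_iff)

lemma positive_op_zero [simp]: "positive_op 0" by (simp add: positive_op_def)

lemma positive_op_one [simp]: "positive_op 1"
  by (simp add: positive_op_def cinner_self del: of_real_power)

lemma positive_op_add: "positive_op S \<Longrightarrow> positive_op T \<Longrightarrow> positive_op (S + T)"
  by (simp add: positive_op_def cinner_add_left)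

lemma positive_op_scaleR: "0 \<le> r \<Longrightarrow> positive_op T \<Longrightarrow> positive_op (r *\<^sub>R T)"
  by (simp add: positive_op_iff cinner_scaleR_left)

lemma positive_op_le_trans:
  "positive_op (S - T) \<Longrightarrow> positive_op (T - U) \<Longrightarrow> positive_op (S - U)"
  using positive_op_add[of "S - T" "T - U"] by simp

text \<open>Both operators are taken positive because \<open>quad\<close> sees only real parts,
  whereas \<open>positive_op\<close> also demands that the form be real.\<close>

lemma positive_op_diff_iff:
  assumes "positive_op S" "positive_op T"
  shows "positive_op (S - T) \<longleftrightarrow> (\<forall>x. quad T x \<le> quad S x)"
  using assms by (auto simp: positive_op_iff cinner_diff_left)

lemma positive_op_conj: "positive_op T \<Longrightarrow> positive_op (C * T * adj C)"
  by (simp add: positive_op_def cinner_adj[of C])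

text \<open>Polarization: reality of the form at x + y and at x + i y yields the imaginary and the
  real part of the symmetry.\<close>

lemma positive_op_hermitian:
  assumes "positive_op T" shows "cinner (app T x) y = cinner x (app T y)"
proof -
  have real: "Im (cinner (app T z) z) = 0" for z
    using assms by (simp add: positive_op_def complex_is_Real_iff)
  have "Im (cinner (app T x) y) + Im (cinner (app T y) x) = 0"
    using real[of "x + y"] real[of x] real[of y] by (simp add: app_add cinner_simps)
  moreover have "Re (cinner (app T y) x) - Re (cinner (app T x) y) = 0"
    using real[of "x + \<i> *\<^sub>C y"] real[of x] real[of y]
    by (simp add: app_add app_scaleC cinner_simps)
  ultimately have "cinner (app T x) y = cnj (cinner (app T y) x)"
    by (simp add: complex_eq_iff)
  then show ?thesis by (metis cinner_commute)
qed

text \<open>\<open>dominated K Z P\<close> is a quadratic-form version of the inequality \<open>|Z| \<le> K P\<close>. Being linear in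
  \<open>P\<close>, it passes through sums \<open>\<Sum>V Z V\<^sup>*\<close> without the Cauchy-Schwarz inequality.\<close>

definition dominated :: "real \<Rightarrow> 'h::complex_hilbert bop \<Rightarrow> 'h bop \<Rightarrow> bool" where
  "dominated K Z P \<longleftrightarrow> (\<forall>x y. cmod (cinner (app Z x) y) \<le> K * (quad P x + quad P y) / 2)"

lemma dominatedD: "dominated K Z P \<Longrightarrow> cmod (cinner (app Z x) y) \<le> K * (quad P x + quad P y) / 2"
  by (simp add: dominated_def)

lemma dominated_one: "dominated (norm T) T 1"
  unfolding dominated_def using cmod_cinner_app_le by auto

text \<open>The computation for the inner product is repeated for the semi-inner product <T x, y>:
  expand the form of T at c x - y with the phase c that aligns <T x, y>.\<close>

lemma positive_op_dominated:
  assumes "positive_op T" shows "dominated 1 T T"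
  unfolding dominated_def
proof (intro allI)
  fix x y
  obtain c where c: "cmod c = 1" "c * cinner (app T x) y = of_real (cmod (cinner (app T x) y))"
    by (rule unimodular_rotate)
  have "cinner (app T y) x = cnj (cinner (app T x) y)"
    using positive_op_hermitian[OF assms] by (metis cinner_commute)
  then have c': "cnj c * cinner (app T y) x = of_real (cmod (cinner (app T x) y))"
    using c(2) by (metis complex_cnj_complex_of_real complex_cnj_mult)
  have "cinner (app T (c *\<^sub>C x)) (c *\<^sub>C x) = c * cnj c * cinner (app T x) x"
    by (simp add: app_scaleC cinner_simps)
  then have cc: "cinner (app T (c *\<^sub>C x)) (c *\<^sub>C x) = cinner (app T x) x"
    using c(1) by (simp add: complex_norm_square[symmetric])
  have "0 \<le> quad T (c *\<^sub>C x - y)" using assms by (rule quad_nonneg)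
  also have "quad T (c *\<^sub>C x - y) = quad T x - 2 * cmod (cinner (app T x) y) + quad T y"
  proof -
    have "cinner (app T (c *\<^sub>C x - y)) (c *\<^sub>C x - y) = cinner (app T (c *\<^sub>C x)) (c *\<^sub>C x)
        - c * cinner (app T x) y - (cnj c * cinner (app T y) x - cinner (app T y) y)"
      by (simp only: app_diff cinner_diff_left cinner_diff_right)
        (simp add: app_scaleC cinner_scaleC_left cinner_scaleC_right algebra_simps)
    then show ?thesis by (simp add: quad_def cc c(2) c')
  qed
  finally show "cmod (cinner (app T x) y) \<le> 1 * (quad T x + quad T y) / 2" by simp
qed

lemma dominated_norm_le:
  assumes "dominated K Z P" "\<And>x. quad P x \<le> c * (norm x)\<^sup>2" "0 \<le> K" "0 \<le> c"
  shows "norm Z \<le> K * c"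
proof (rule norm_bop_le_quadratic)
  fix x y
  have "cmod (cinner (app Z x) y) \<le> K * (quad P x + quad P y) / 2" by (rule dominatedD[OF assms(1)])
  also have "\<dots> \<le> K * (c * (norm x)\<^sup>2 + c * (norm y)\<^sup>2) / 2"
    using assms by (intro divide_right_mono mult_left_mono add_mono) simp_all
  finally show "cmod (cinner (app Z x) y) \<le> K * c * ((norm x)\<^sup>2 + (norm y)\<^sup>2) / 2"
    by (simp add: algebra_simps)
qed (use assms in simp)

lemma quad_le_norm: "quad T x \<le> norm T * (norm x)\<^sup>2"
  using cmod_cinner_app_le[of T x x] complex_Re_le_cmod[of "cinner (app T x) x"]
  unfolding quad_def by simp

lemma positive_op_norm_le:
  assumes "positive_op T" "\<And>x. quad T x \<le> c * (norm x)\<^sup>2" "0 \<le> c"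
  shows "norm T \<le> c"
  using dominated_norm_le[OF positive_op_dominated assms(2)] assms by simp

lemma dominated_norm: "dominated K Z P \<Longrightarrow> 0 \<le> K \<Longrightarrow> norm Z \<le> K * norm P"
  by (rule dominated_norm_le[OF _ quad_le_norm]) simp_all

text \<open>With S the inverse of T, t |x|^2 = <T (t x), S x>. Domination bounds this by half of t^2
  <T x, x> + <T S x, S x>, and the last term is at most t |x|^2, so it can be absorbed on the
  left.\<close>

lemma positive_invertible_lower_bound:
  assumes T: "positive_op T" and inv: "invertible_op T"
  obtains g where "0 < g" "positive_op (T - g *\<^sub>R 1)"
proof -
  obtain S where S: "S * T = 1" "T * S = 1" using inv by (auto simp: invertible_op_def)
  \<comment> \<open>Any positive bound for the norm of \<open>S\<close> would do; the 1 covers the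
    trivial space, where \<open>S\<close> may vanish.\<close>
  define t where "t = norm S + 1"
  have t: "0 < t" "norm S \<le> t" by (simp_all add: t_def add_nonneg_pos)
  have "(1 / t) * (norm x)\<^sup>2 \<le> quad T x" for x
  proof -
    have TS: "app T (app S x) = x" using S(2) by (metis app_simps(6,7))
    have qS: "quad T (app S x) \<le> t * (norm x)\<^sup>2"
    proof -
      have "quad T (app S x) = quad S x" by (simp add: quad_def TS Re_cinner_commute)
      also have "\<dots> \<le> t * (norm x)\<^sup>2"
        using quad_le_norm[of S x] t by (meson mult_right_mono order_trans zero_le_power2)
      finally show ?thesis .
    qed
    have "t * (norm x)\<^sup>2 = cmod (cinner (app T (t *\<^sub>R x)) (app S x))"
      using t by (simp add: app_scaleR cinner_scaleR_left positive_op_hermitian[OF T, of x] TS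
          cinner_self norm_mult norm_power)
    also have "\<dots> \<le> (quad T (t *\<^sub>R x) + quad T (app S x)) / 2"
      using dominatedD[OF positive_op_dominated[OF T]] by simp
    also have "\<dots> = (t * t * quad T x + quad T (app S x)) / 2"
      by (simp add: quad_def app_scaleR cinner_simps mult.assoc)
    finally have "t * (norm x)\<^sup>2 \<le> t * (t * quad T x)" using qS by simp
    then show ?thesis using t by (simp add: field_simps)
  qed
  then have "positive_op (T - (1 / t) *\<^sub>R 1)"
    using t by (subst positive_op_diff_iff) (auto intro: T positive_op_scaleR)
  then show ?thesis using that[of "1 / t"] t by simp
qed

lemma closed_positive_op: "closed {T :: 'h::complex_hilbert bop. positive_op T}"
proof -
  have cont: "continuous_on UNIV (\<lambda>T. cinner (app T x) x)" for x :: 'h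
    by (intro linear_continuous_on bounded_linear_compose[OF bounded_linear_cinner_left bounded_linear_app_left])
  have "{T :: 'h bop. positive_op T} =
      (\<Inter>x. {T. Im (cinner (app T x) x) = 0} \<inter> {T. 0 \<le> Re (cinner (app T x) x)})"
    by (auto simp: positive_op_def complex_is_Real_iff)
  also have "closed \<dots>"
    by (intro closed_INT closed_Int ballI closed_Collect_eq closed_Collect_le continuous_intros cont)
  finally show ?thesis .
qed

lemma positive_op_sums:
  assumes "f sums S" "\<And>n. positive_op (f n)" shows "positive_op S"
proof -
  have "positive_op (\<Sum>i<n. f i)" for n
    by (induction n) (simp_all add: positive_op_add assms)
  then show ?thesis
    using closed_sequentially[OF closed_positive_op, of "\<lambda>n. \<Sum>i<n. f i" S] assms(1)
    by (simp add: sums_def)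
qed


section \<open>Power series in one operator: inverses and square roots\<close>

lemma norm_one_bop_le: "norm (1 :: 'h::complex_hilbert bop) \<le> 1"
  by (rule norm_bop_bound) simp_all

lemma norm_power_bop_le: "norm (E ^ n) \<le> norm E ^ n" for E :: "'h::complex_hilbert bop"
proof (induction n)
  case (Suc n)
  then show ?case
    using norm_mult_ineq[of E "E ^ n"] by (simp add: mult_left_mono order_trans)
qed (simp add: norm_one_bop_le)

lemma summable_norm_power_series:
  fixes E :: "'h::complex_hilbert bop"
  assumes "norm E < 1" "\<And>n. \<bar>c n\<bar> \<le> 1"
  shows "summable (\<lambda>n. norm (c n *\<^sub>R E ^ n))"
proof (rule summable_comparison_test')
  show "summable (\<lambda>n. norm E ^ n)" using assms by (simp add: summable_geometric)
  show "norm (norm (c n *\<^sub>R E ^ n)) \<le> norm E ^ n" for n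
    using mult_mono[OF assms(2)[of n] norm_power_bop_le[of E n]] by simp
qed

text \<open>Coefficients bounded by 1 cover the series in use: the geometric one, the polynomial 1 -
  x, and the binomial series with exponent 1/2. Operator identities thereby reduce to convolutions
  of real sequences.\<close>

lemma power_series_product_sums:
  fixes E :: "'h::complex_hilbert bop"
  assumes E: "norm E < 1" and c: "\<And>n. \<bar>c n\<bar> \<le> 1" and d: "\<And>n. \<bar>d n\<bar> \<le> 1"
  shows "(\<lambda>k. (\<Sum>i\<le>k. c i * d (k - i)) *\<^sub>R E ^ k) sums
    (suminf (\<lambda>n. c n *\<^sub>R E ^ n) * suminf (\<lambda>n. d n *\<^sub>R E ^ n))"
proof -
  have "(\<Sum>i\<le>k. (c i *\<^sub>R E ^ i) * (d (k - i) *\<^sub>R E ^ (k - i)))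
      = (\<Sum>i\<le>k. c i * d (k - i)) *\<^sub>R E ^ k" for k
    unfolding scaleR_sum_left by (intro sum.cong refl) (simp add: power_add[symmetric] mult.commute[of "d _"])
  moreover have "(\<lambda>k. \<Sum>i\<le>k. (c i *\<^sub>R E ^ i) * (d (k - i) *\<^sub>R E ^ (k - i))) sums
    (suminf (\<lambda>n. c n *\<^sub>R E ^ n) * suminf (\<lambda>n. d n *\<^sub>R E ^ n))"
    by (intro Cauchy_product_sums summable_norm_power_series E c d)
  ultimately show ?thesis by (simp only:)
qed

lemma sums_one_minus:
  fixes E :: "'h::complex_hilbert bop"
  assumes "d 0 = 1" "d 1 = -1" "\<And>n. 2 \<le> n \<Longrightarrow> d n = 0"
  shows "(\<lambda>n. d n *\<^sub>R E ^ n) sums (1 - E)"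
proof -
  have "(\<lambda>n. d n *\<^sub>R E ^ n) sums (\<Sum>n\<in>{0, 1}. d n *\<^sub>R E ^ n)"
    by (rule sums_finite) (use assms(3) in \<open>auto simp: not_less_eq_eq numeral_2_eq_2 le_Suc_eq\<close>)
  then show ?thesis using assms by simp
qed

text \<open>The convolution of 1, 1, 1, ... with 1, -1, 0, ... is the unit sequence. It is used in
  both orders, since a two-sided inverse is required.\<close>

lemma Neumann_inverse:
  fixes E :: "'h::complex_hilbert bop"
  assumes E: "norm E < 1" shows "invertible_op (1 - E)"
proof -
  define d :: "nat \<Rightarrow> real" where "d n = (if n = 0 then 1 else if n = 1 then -1 else 0)" for n
  define S where "S = suminf (\<lambda>n. 1 *\<^sub>R E ^ n)"
  have d: "\<bar>d n\<bar> \<le> 1" for n by (simp add: d_def)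
  have dE: "suminf (\<lambda>n. d n *\<^sub>R E ^ n) = 1 - E"
    by (rule sums_unique[symmetric], rule sums_one_minus) (simp_all add: d_def)
  have sum_d: "(\<Sum>i\<le>k. d i) = (if k = 0 then 1 else 0)" for k
    by (induction k) (auto simp: d_def)
  have sum_d': "(\<Sum>i\<le>k. d (k - i)) = (if k = 0 then 1 else 0)" for k
    using sum.nat_diff_reindex[of d "Suc k"] sum_d[of k] by (simp add: lessThan_Suc_atMost)
  have one: "(\<lambda>k. (if k = 0 then 1 else 0) *\<^sub>R E ^ k) sums (1 :: 'h bop)"
    using sums_finite[of "{0}" "\<lambda>k. (if k = 0 then 1 else 0) *\<^sub>R E ^ k"] by simp
  have "(\<lambda>k. (\<Sum>i\<le>k. d i * 1) *\<^sub>R E ^ k) sums (suminf (\<lambda>n. d n *\<^sub>R E ^ n) * S)"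
    unfolding S_def by (rule power_series_product_sums) (simp_all add: E d)
  then have "(1 - E) * S = 1"
    using one by (simp add: sum_d dE sums_unique2)
  moreover have "(\<lambda>k. (\<Sum>i\<le>k. 1 * d (k - i)) *\<^sub>R E ^ k) sums (S * suminf (\<lambda>n. d n *\<^sub>R E ^ n))"
    unfolding S_def by (rule power_series_product_sums) (simp_all add: E d)
  then have "S * (1 - E) = 1"
    using one by (simp add: sum_d' dE sums_unique2)
  ultimately show ?thesis by (auto simp: invertible_op_def)
qed

text \<open>The recurrence multiplies by (1/2 - n) / (n + 1), whose modulus is at most 1.\<close>

lemma abs_half_gchoose_le: "\<bar>(1/2 :: real) gchoose n\<bar> \<le> 1"
proof (induction n)
  case (Suc n)
  have "real (Suc n) * ((1/2) gchoose Suc n) = (1/2 - real n) * ((1/2) gchoose n)"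
    using gbinomial_mult_1[of "1/2 :: real" n] by (simp add: left_diff_distrib)
  then have "real (Suc n) * \<bar>(1/2 :: real) gchoose Suc n\<bar> = \<bar>(1/2 - real n) * ((1/2) gchoose n)\<bar>"
    by (subst abs_of_nat[symmetric], subst abs_mult[symmetric]) simp
  also have "\<dots> \<le> real (Suc n) * 1"
    unfolding abs_mult using Suc.IH by (intro mult_mono) auto
  finally show ?case by simp
qed simp

text \<open>Binomial series of (1 - x)^(1/2): by Vandermonde the convolution square of its
  coefficients has exponent 1/2 + 1/2 = 1, hence stops after the linear term. Real coefficients and
  Hermitian powers of E make the sum self-adjoint.\<close>

lemma sqrt_one_minus:
  fixes E :: "'h::complex_hilbert bop"
  assumes E: "norm E < 1" "positive_op E"
  obtains Z where "adj Z = Z" "Z * Z = 1 - E"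
proof -
  define c where "c n = (-1) ^ n * ((1/2 :: real) gchoose n)" for n
  define Z where "Z = suminf (\<lambda>n. c n *\<^sub>R E ^ n)"
  have c: "\<bar>c n\<bar> \<le> 1" for n by (simp add: c_def abs_mult abs_half_gchoose_le)
  have conv: "(\<Sum>i\<le>k. c i * c (k - i)) = (-1) ^ k * (1 gchoose k)" for k
  proof -
    have "(\<Sum>i\<le>k. c i * c (k - i)) = (\<Sum>i\<le>k. (-1) ^ k * (((1/2) gchoose i) * ((1/2) gchoose (k - i))))"
      by (intro sum.cong) (simp_all add: c_def power_add[symmetric] mult.assoc mult.left_commute)
    also have "\<dots> = (-1) ^ k * (1 gchoose k)"
      using gbinomial_Vandermonde[of "1/2 :: real" "1/2" k]
      by (simp add: sum_distrib_left[symmetric] atMost_atLeast0)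
    finally show ?thesis .
  qed
  have "(1 :: real) gchoose n = 0" if "2 \<le> n" for n
    using that binomial_gbinomial[of 1 n, where ?'a = real] by (simp add: binomial_eq_0)
  then have "(\<lambda>k. (\<Sum>i\<le>k. c i * c (k - i)) *\<^sub>R E ^ k) sums (1 - E)"
    unfolding conv by (intro sums_one_minus) simp_all
  moreover have "(\<lambda>k. (\<Sum>i\<le>k. c i * c (k - i)) *\<^sub>R E ^ k) sums (Z * Z)"
    unfolding Z_def by (rule power_series_product_sums) (simp_all add: E c)
  ultimately have "Z * Z = 1 - E" by (rule sums_unique2[symmetric])
  moreover have "adj Z = Z"
  proof (rule adj_eqI)
    fix x y
    have sums: "(\<lambda>n. c n *\<^sub>R E ^ n) sums Z"
      unfolding Z_def
      by (rule summable_sums, rule summable_norm_cancel, rule summable_norm_power_series) (rule E c)+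
    have pow: "cinner (app (E ^ n) x) y = cinner x (app (E ^ n) y)" for n x y
    proof (induction n arbitrary: x y)
      case (Suc n)
      have "cinner (app (E ^ Suc n) x) y = cinner x (app (E ^ n * E) y)"
        by (simp add: positive_op_hermitian[OF E(2)] Suc.IH)
      then show ?case by (simp add: power_commutes)
    qed simp
    have "(\<lambda>n. cinner (app (c n *\<^sub>R E ^ n) x) y) sums cinner (app Z x) y"
      by (intro bounded_linear.sums[OF bounded_linear_cinner_left]
          bounded_linear.sums[OF bounded_linear_app_left] sums)
    moreover have "(\<lambda>n. cinner x (app (c n *\<^sub>R E ^ n) y)) sums cinner x (app Z y)"
      by (intro bounded_linear.sums[OF bounded_linear_cinner_right]
          bounded_linear.sums[OF bounded_linear_app_left] sums)
    ultimately show "cinner (app Z x) y = cinner x (app Z y)"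
      by (simp add: cinner_simps pow sums_unique2)
  qed
  ultimately show ?thesis using that by blast
qed

text \<open>Rescaling by a bound \<open>M\<close> of T puts T / M between g / M and 1, so E = 1 - T
  / M is positive with norm below 1. Power series in E then give both the inverse and the square
  root of T.\<close>

lemma lower_bound_scale:
  fixes T :: "'h::complex_hilbert bop"
  assumes T: "positive_op T" and g: "0 < g" "positive_op (T - g *\<^sub>R 1)"
  obtains M E where "0 < M" "T = M *\<^sub>R (1 - E)" "norm E < 1" "positive_op E"
proof -
  define M where "M = norm T + 1"
  define E where "E = 1 - (1 / M) *\<^sub>R T"
  have M: "0 < M" by (simp add: M_def add_nonneg_pos)
  have lower: "g * (norm x)\<^sup>2 \<le> quad T x" for x using quad_nonneg[OF g(2), of x] by simp
  have "quad T x \<le> M * (norm x)\<^sup>2" for x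
    using quad_le_norm[of T x] zero_le_power2[of "norm x"] unfolding M_def distrib_right by linarith
  then have pos: "positive_op E"
    unfolding E_def using M by (subst positive_op_diff_iff) (auto intro: T positive_op_scaleR simp: field_simps)
  \<comment> \<open>The maximum covers the trivial space, where g may exceed M.\<close>
  have "norm E \<le> max 0 (1 - g / M)"
  proof (rule positive_op_norm_le[OF pos])
    fix x
    have "quad E x \<le> (1 - g / M) * (norm x)\<^sup>2"
      using lower[of x] M by (simp add: E_def field_simps)
    also have "\<dots> \<le> max 0 (1 - g / M) * (norm x)\<^sup>2" by (intro mult_right_mono) simp_all
    finally show "quad E x \<le> max 0 (1 - g / M) * (norm x)\<^sup>2" .
  qed simp
  moreover have "0 < g / M" using g M by simp
  ultimately have "norm E < 1" by linarith
  moreover have "T = M *\<^sub>R (1 - E)" using M by (simp add: E_def)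
  ultimately show ?thesis using that M pos by blast
qed

lemma invertible_opI: "S * T = 1 \<Longrightarrow> T * S = 1 \<Longrightarrow> invertible_op T"
  by (auto simp: invertible_op_def)

lemma invertible_opE:
  assumes "invertible_op T"
  obtains S where "S * T = 1" "T * S = 1"
  using assms by (auto simp: invertible_op_def)

lemma invertible_op_times:
  assumes "invertible_op S" "invertible_op T" shows "invertible_op (S * T)"
proof -
  obtain S' where S': "S' * S = 1" "S * S' = 1" using assms(1) by (rule invertible_opE)
  obtain T' where T': "T' * T = 1" "T * T' = 1" using assms(2) by (rule invertible_opE)
  have "(T' * S') * (S * T) = T' * (S' * S) * T" "(S * T) * (T' * S') = S * (T * T') * S'"
    by (simp_all only: mult.assoc)
  then show ?thesis by (intro invertible_opI[of "T' * S'"]) (simp_all add: S' T')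
qed

lemma invertible_op_scaleR:
  assumes "invertible_op T" "r \<noteq> 0" shows "invertible_op (r *\<^sub>R T)"
proof -
  obtain S where "S * T = 1" "T * S = 1" using assms(1) by (rule invertible_opE)
  then show ?thesis using assms(2) by (intro invertible_opI[of "inverse r *\<^sub>R S"]) simp_all
qed

lemma positive_lower_bound_invertible:
  assumes "positive_op T" "0 < g" "positive_op (T - g *\<^sub>R 1)"
  shows "invertible_op T"
  by (rule lower_bound_scale[OF assms]) (auto intro!: invertible_op_scaleR Neumann_inverse)

lemma positive_invertible_sqrt:
  assumes T: "positive_op T" "invertible_op T"
  obtains Z where "adj Z = Z" "Z * Z = T" "invertible_op Z"
proof -
  obtain g where "0 < g" "positive_op (T - g *\<^sub>R 1)"
    using T by (rule positive_invertible_lower_bound)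
  with T(1) obtain M E where M: "0 < M" "T = M *\<^sub>R (1 - E)" "norm E < 1" "positive_op E"
    by (rule lower_bound_scale)
  obtain Z0 where Z0: "adj Z0 = Z0" "Z0 * Z0 = 1 - E" using M by (auto intro: sqrt_one_minus)
  define Z where "Z = sqrt M *\<^sub>R Z0"
  have adj_Z: "adj Z = Z"
  proof (rule adj_eqI)
    show "cinner (app Z x) y = cinner x (app Z y)" for x y
      using cinner_adj[of Z0 x y] by (simp add: Z_def Z0 cinner_simps)
  qed
  have ZZ: "Z * Z = T"
    using M(1) by (simp add: Z_def Z0 M(2))
  obtain S where "S * T = 1" "T * S = 1" using T(2) by (rule invertible_opE)
  then have SZ: "(S * Z) * Z = 1" "Z * (Z * S) = 1"
    by (simp_all add: ZZ[symmetric] mult.assoc)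
  \<comment> \<open>\<open>S * Z\<close> is a left inverse and \<open>Z * S\<close> a right inverse
    of \<open>Z\<close>; the two must agree.\<close>
  have "S * Z = (S * Z) * (Z * (Z * S))" by (simp add: SZ(2))
  also have "\<dots> = ((S * Z) * Z) * (Z * S)" by (simp only: mult.assoc)
  also have "\<dots> = Z * S" by (simp add: SZ(1))
  finally have "Z * (S * Z) = 1" using SZ(2) by simp
  with SZ(1) have "invertible_op Z" by (rule invertible_opI)
  with adj_Z ZZ show ?thesis by (rule that)
qed

section \<open>The maps induced by free holomorphic functions\<close>

definition admissible ::
    "nat \<Rightarrow> (nat list \<Rightarrow> real) \<Rightarrow> (nat \<Rightarrow> 'h::complex_hilbert bop) \<Rightarrow> bool" where
  "admissible n a X \<longleftrightarrow> (\<forall>w\<in>lists {1..n}. 0 \<le> a w) \<and> Phi_well_defined n a X"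

lemma has_wot_sum_unique:
  assumes "has_wot_sum F S I" "has_wot_sum F T I" shows "S = T"
  by (rule bop_cinner_eqI) (use assms has_sum_unique in \<open>unfold has_wot_sum_def, blast\<close>)

lemma has_wot_sum_cong: "(\<And>i. i \<in> I \<Longrightarrow> F i = G i) \<Longrightarrow> has_wot_sum F S I = has_wot_sum G S I"
  unfolding has_wot_sum_def by (intro all_cong1 has_sum_cong) simp

lemma has_wot_sum_conj:
  "has_wot_sum F S I \<Longrightarrow> has_wot_sum (\<lambda>i. C * F i * adj C) (C * S * adj C) I"
  by (simp add: has_wot_sum_def cinner_adj[of C])

lemma Phi_eqI:
  assumes "has_wot_sum (\<lambda>w. a w *\<^sub>R (word_op X w * Y * adj (word_op X w))) S (lists {1..n})"
  shows "Phi n a X Y = S"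
  unfolding Phi_def using assms has_wot_sum_unique by blast

lemma cinner_Phi_term:
  "cinner (app (a w *\<^sub>R (word_op X w * Y * adj (word_op X w))) x) y
    = of_real (a w) * cinner (app Y (app (adj (word_op X w)) x)) (app (adj (word_op X w)) y)"
  by (simp add: cinner_adj[of "word_op X w"] cinner_scaleR_left)

text \<open>The diagonal of the weak sum at the identity is a convergent series of nonnegative
  reals; it is the majorant for everything that follows.\<close>

lemma admissible_norm_has_sum:
  assumes "admissible n a X"
  obtains S where "\<And>x. ((\<lambda>w. a w * (norm (app (adj (word_op X w)) x))\<^sup>2) has_sum quad S x) (lists {1..n})"
proof -
  obtain S where S: "has_wot_sum (\<lambda>w. a w *\<^sub>R (word_op X w * adj (word_op X w))) S (lists {1..n})"
    using assms by (auto simp: admissible_def Phi_well_defined_def)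
  have "((\<lambda>w. a w * (norm (app (adj (word_op X w)) x))\<^sup>2) has_sum quad S x) (lists {1..n})" for x
  proof -
    have "((\<lambda>w. Re (cinner (app (a w *\<^sub>R (word_op X w * adj (word_op X w))) x) x)) has_sum quad S x) (lists {1..n})"
      unfolding quad_def using S by (intro has_sum_Re) (simp add: has_wot_sum_def)
    then show ?thesis
      using cinner_Phi_term[of a _ X 1] by (simp add: cinner_self del: of_real_power)
  qed
  then show ?thesis by (rule that)
qed

text \<open>This makes \<open>Phi\<close> meaningful at every operator. Each matrix coefficient is
  dominated by the two diagonal series at x and y, so the coefficients sum absolutely to a bounded
  sesquilinear form, which is the form of an operator.\<close>

lemma Phi_has_wot_sum:
  fixes X :: "nat \<Rightarrow> 'h::complex_hilbert bop"
  assumes adm: "admissible n a X"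
  shows "has_wot_sum (\<lambda>w. a w *\<^sub>R (word_op X w * Y * adj (word_op X w))) (Phi n a X Y) (lists {1..n})"
proof -
  let ?W = "lists {1..n}"
  define U where "U w = app (adj (word_op X w))" for w
  define t where "t x y w = of_real (a w) * cinner (app Y (U w x)) (U w y)" for x y w
  define B where "B x y = infsum (t x y) ?W" for x y
  obtain S where S: "\<And>x. ((\<lambda>w. a w * (norm (U w x))\<^sup>2) has_sum quad S x) ?W"
    by (rule admissible_norm_has_sum[OF adm]) (unfold U_def, blast)
  have a: "0 \<le> a w" if "w \<in> ?W" for w using adm that by (simp add: admissible_def)
  have major: "((\<lambda>w. norm Y * (a w * (norm (U w x))\<^sup>2 + a w * (norm (U w y))\<^sup>2) / 2)
      has_sum (norm Y * (quad S x + quad S y) / 2)) ?W" for x y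
    by (intro has_sum_divide_const has_sum_cmult_right has_sum_add S)
  have t_le: "cmod (t x y w) \<le> norm Y * (a w * (norm (U w x))\<^sup>2 + a w * (norm (U w y))\<^sup>2) / 2"
    if "w \<in> ?W" for x y w
  proof -
    have "cmod (t x y w) = a w * cmod (cinner (app Y (U w x)) (U w y))"
      using a[OF that] by (simp add: t_def norm_mult)
    also have "\<dots> \<le> a w * (norm Y * ((norm (U w x))\<^sup>2 + (norm (U w y))\<^sup>2) / 2)"
      using a[OF that] by (intro mult_left_mono cmod_cinner_app_le)
    finally show ?thesis by (simp add: algebra_simps)
  qed
  have sum: "(t x y has_sum B x y) ?W" for x y
    unfolding B_def
  proof (rule has_sum_infsum, rule Infinite_Sum.abs_summable_summable)
    show "(\<lambda>w. norm (t x y w)) summable_on ?W"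
      by (rule Infinite_Sum.abs_summable_on_comparison_test'[OF has_sum_imp_summable[OF major[of x y]]], rule t_le)
  qed
  have U_add: "U w (x + y) = U w x + U w y" and U_scale: "U w (c *\<^sub>C x) = c *\<^sub>C U w x" for w x y c
    by (simp_all add: U_def app_add app_scaleC)
  have uniq: "B x y = s" if "(f has_sum s) ?W" "f = t x y" for x y s f
    using sum[of x y] that has_sum_unique by blast
  have "\<exists>T. \<forall>x y. cinner (app T x) y = B x y"
  proof (rule sesquilinear_form_op[of B "norm Y * norm S"])
    show "B (x + x') y = B x y + B x' y" for x x' y
      by (rule uniq[OF has_sum_add[OF sum sum]])
        (auto simp: t_def U_add app_add cinner_simps algebra_simps)
    show "B x (y + y') = B x y + B x y'" for x y y'
      by (rule uniq[OF has_sum_add[OF sum sum]])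
        (auto simp: t_def U_add app_add cinner_simps algebra_simps)
    show "B (c *\<^sub>C x) y = c * B x y" for c x y
      by (rule uniq[OF has_sum_cmult_right[OF sum]])
        (auto simp: t_def U_scale app_scaleC cinner_simps)
    show "B x (c *\<^sub>C y) = cnj c * B x y" for c x y
      by (rule uniq[OF has_sum_cmult_right[OF sum]])
        (auto simp: t_def U_scale app_scaleC cinner_simps)
    fix x y
    have "cmod (B x y) \<le> norm Y * (quad S x + quad S y) / 2"
      by (rule norm_infsum_le[OF sum[of x y] major[of x y]], rule t_le)
    also have "\<dots> \<le> norm Y * (norm S * (norm x)\<^sup>2 + norm S * (norm y)\<^sup>2) / 2"
      by (intro divide_right_mono mult_left_mono add_mono quad_le_norm) simp_all
    finally show "cmod (B x y) \<le> norm Y * norm S * ((norm x)\<^sup>2 + (norm y)\<^sup>2) / 2"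
      by (simp add: algebra_simps)
  qed blast
  then obtain T where T: "\<And>x y. cinner (app T x) y = B x y" by blast
  have "has_wot_sum (\<lambda>w. a w *\<^sub>R (word_op X w * Y * adj (word_op X w))) T ?W"
    using sum unfolding has_wot_sum_def cinner_Phi_term T t_def U_def by blast
  then show ?thesis using Phi_eqI by metis
qed

lemma Phi_has_sum:
  assumes "admissible n a X"
  shows "((\<lambda>w. of_real (a w) * cinner (app Y (app (adj (word_op X w)) x)) (app (adj (word_op X w)) y))
    has_sum cinner (app (Phi n a X Y) x) y) (lists {1..n})"
  using Phi_has_wot_sum[OF assms, of Y] unfolding has_wot_sum_def cinner_Phi_term by blast

lemma Phi_has_sum_quad:
  assumes "admissible n a X"
  shows "((\<lambda>w. a w * quad Y (app (adj (word_op X w)) x)) has_sum quad (Phi n a X Y) x) (lists {1..n})"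
  unfolding quad_def using has_sum_Re[OF Phi_has_sum[OF assms, of Y x x]] by simp

lemma Phi_add: 
  assumes "admissible n a X"
  shows "Phi n a X (Y + Z) = Phi n a X Y + Phi n a X Z"
proof (rule bop_cinner_eqI)
  fix x y
  show "cinner (app (Phi n a X (Y + Z)) x) y = cinner (app (Phi n a X Y + Phi n a X Z) x) y"
    using has_sum_add[OF Phi_has_sum[OF assms, of Y x y] Phi_has_sum[OF assms, of Z x y]]
      Phi_has_sum[OF assms, of "Y + Z" x y]
    by (simp add: cinner_add_left distrib_left has_sum_unique)
qed

lemma Phi_scaleR:
  assumes "admissible n a X"
  shows "Phi n a X (r *\<^sub>R Y) = r *\<^sub>R Phi n a X Y"
proof (rule bop_cinner_eqI)
  fix x y
  show "cinner (app (Phi n a X (r *\<^sub>R Y)) x) y = cinner (app (r *\<^sub>R Phi n a X Y) x) y"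
    using has_sum_cmult_right[OF Phi_has_sum[OF assms, of Y x y], of "of_real r"]
      Phi_has_sum[OF assms, of "r *\<^sub>R Y" x y]
    by (simp add: cinner_scaleR_left mult.left_commute has_sum_unique)
qed

lemma Phi_dominated:
  assumes adm: "admissible n a X" and dom: "dominated K Z P"
  shows "dominated K (Phi n a X Z) (Phi n a X P)"
  unfolding dominated_def
proof (intro allI)
  fix x y
  let ?U = "\<lambda>w. app (adj (word_op X w))"
  show "cmod (cinner (app (Phi n a X Z) x) y) \<le> K * (quad (Phi n a X P) x + quad (Phi n a X P) y) / 2"
  proof (rule norm_infsum_le[OF Phi_has_sum[OF adm]])
    show "((\<lambda>w. K * (a w * quad P (?U w x) + a w * quad P (?U w y)) / 2)
      has_sum (K * (quad (Phi n a X P) x + quad (Phi n a X P) y) / 2)) (lists {1..n})"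
      by (intro has_sum_divide_const has_sum_cmult_right has_sum_add Phi_has_sum_quad adm)
    fix w assume "w \<in> lists {1..n}"
    then have a: "0 \<le> a w" using adm by (simp add: admissible_def)
    have "a w * cmod (cinner (app Z (?U w x)) (?U w y))
        \<le> a w * (K * (quad P (?U w x) + quad P (?U w y)) / 2)"
      using a by (intro mult_left_mono dominatedD dom)
    then show "cmod (of_real (a w) * cinner (app Z (?U w x)) (?U w y))
        \<le> K * (a w * quad P (?U w x) + a w * quad P (?U w y)) / 2"
      using a by (simp add: norm_mult algebra_simps)
  qed
qed

lemma Phi_positive:
  assumes adm: "admissible n a X" and P: "positive_op P"
  shows "positive_op (Phi n a X P)"
  unfolding positive_op_iff
proof (intro allI conjI)
  fix x
  have "((\<lambda>w. of_real (a w * quad P (app (adj (word_op X w)) x))) has_sum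
      (of_real (quad (Phi n a X P) x) :: complex)) (lists {1..n})"
    by (rule has_sum_of_real[OF Phi_has_sum_quad[OF adm]])
  moreover have "cinner (app P z) z = of_real (quad P z)" for z
    using P by (simp add: positive_op_iff)
  ultimately show "cinner (app (Phi n a X P) x) x = of_real (quad (Phi n a X P) x)"
    using Phi_has_sum[OF adm, of P x x] by (simp add: has_sum_unique)
  show "0 \<le> quad (Phi n a X P) x"
    using has_sum_nonneg[OF Phi_has_sum_quad[OF adm]] adm quad_nonneg[OF P]
    by (simp add: admissible_def)
qed

section \<open>Commutation and similarity of words\<close>

lemma word_op_Nil [simp]: "word_op X [] = 1"
  by (simp add: word_op_def)

lemma word_op_Cons [simp]: "word_op X (j # w) = X j * word_op X w"
  by (simp add: word_op_def)

lemma commute_times: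
  fixes S T U :: "'a::semigroup_mult"
  assumes "S * U = U * S" "T * U = U * T" shows "(S * T) * U = U * (S * T)"
  using assms by (metis mult.assoc)

lemma word_op_commute:
  assumes comm: "\<And>j l. j \<in> J \<Longrightarrow> l \<in> L \<Longrightarrow> X j * Y l = Y l * X j"
    and v: "v \<in> lists J" and w: "w \<in> lists L"
  shows "word_op X v * word_op Y w = word_op Y w * word_op X v"
proof -
  have letter: "word_op Y w * X j = X j * word_op Y w" if "j \<in> J" for j
    using w
  proof (induction w)
    case (Cons l w)
    then show ?case unfolding word_op_Cons using comm[OF that] by (intro commute_times) simp_all
  qed simp
  show ?thesis using v
  proof (induction v)
    case (Cons j v)
    then show ?case unfolding word_op_Cons using letter by (intro commute_times) simp_all
  qed simp
qed

text \<open>Both composites are iterated sums of one double series over pairs of words, because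
  adjoints of words in different groups of variables commute. Absolute summability permits the
  exchange.\<close>

lemma Phi_commute:
  fixes X Y :: "nat \<Rightarrow> 'h::complex_hilbert bop"
  assumes X: "admissible n a X" and Y: "admissible l b Y"
    and comm: "\<And>i j. i \<in> {1..n} \<Longrightarrow> j \<in> {1..l} \<Longrightarrow> X i * Y j = Y j * X i"
  shows "Phi n a X (Phi l b Y Z) = Phi l b Y (Phi n a X Z)"
proof (rule bop_cinner_eqI)
  fix x y
  define U where "U w = app (adj (word_op X w))" for w
  define V where "V w = app (adj (word_op Y w))" for w
  define F where "F = (\<lambda>(w, v). of_real (a w) * (of_real (b v) * cinner (app Z (V v (U w x))) (V v (U w y))))"
  have UV: "V v (U w z) = U w (V v z)" if "w \<in> lists {1..n}" "v \<in> lists {1..l}" for w v z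
  proof -
    have "word_op X w * word_op Y v = word_op Y v * word_op X w"
      using comm that by (intro word_op_commute[of "{1..n}" "{1..l}" X Y])
    then have "adj (word_op Y v) * adj (word_op X w) = adj (word_op X w) * adj (word_op Y v)"
      by (simp only: adj_times[symmetric])
    then have "app (adj (word_op Y v) * adj (word_op X w)) z = app (adj (word_op X w) * adj (word_op Y v)) z"
      by (rule arg_cong)
    then show ?thesis by (simp add: U_def V_def)
  qed
  have inner: "((\<lambda>v. F (w, v)) has_sum (of_real (a w) * cinner (app (Phi l b Y Z) (U w x)) (U w y))) (lists {1..l})" for w
    unfolding F_def V_def prod.case by (intro has_sum_cmult_right Phi_has_sum Y)
  have outer: "((\<lambda>w. of_real (a w) * cinner (app (Phi l b Y Z) (U w x)) (U w y)) has_sum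
      cinner (app (Phi n a X (Phi l b Y Z)) x) y) (lists {1..n})"
    unfolding U_def by (rule Phi_has_sum[OF X])
  have inner': "((\<lambda>w. F (w, v)) has_sum (of_real (b v) * cinner (app (Phi n a X Z) (V v x)) (V v y))) (lists {1..n})"
    if "v \<in> lists {1..l}" for v
  proof -
    have "((\<lambda>w. of_real (b v) * (of_real (a w) * cinner (app Z (U w (V v x))) (U w (V v y)))) has_sum
        (of_real (b v) * cinner (app (Phi n a X Z) (V v x)) (V v y))) (lists {1..n})"
      unfolding U_def by (intro has_sum_cmult_right Phi_has_sum X)
    then show ?thesis
      by (rule has_sum_cong[THEN iffD1, rotated]) (simp add: F_def UV that del: One_nat_def)
  qed
  have outer': "((\<lambda>v. of_real (b v) * cinner (app (Phi n a X Z) (V v x)) (V v y)) has_sum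
      cinner (app (Phi l b Y (Phi n a X Z)) x) y) (lists {1..l})"
    unfolding V_def by (rule Phi_has_sum[OF Y])
  \<comment> \<open>The diagonal double series with the identity in place of \<open>Z\<close>. Its
    terms are nonnegative, so its iterated sum gives summability, and \<open>G x + G y\<close>
    dominates \<open>F\<close>.\<close>
  define G where "G z = (\<lambda>(w, v). a w * (b v * (norm (V v (U w z)))\<^sup>2))" for z
  have G: "G z summable_on (lists {1..n} \<times> lists {1..l})" for z
  proof (rule summable_on_SigmaI)
    show "((\<lambda>v. G z (w, v)) has_sum (a w * quad (Phi l b Y 1) (U w z))) (lists {1..l})" for w
      unfolding G_def prod.case V_def
      using Phi_has_sum_quad[OF Y, of 1] by (intro has_sum_cmult_right) simp
    show "(\<lambda>w. a w * quad (Phi l b Y 1) (U w z)) summable_on lists {1..n}"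
      unfolding U_def by (rule has_sum_imp_summable[OF Phi_has_sum_quad[OF X]])
    show "0 \<le> G z (w, v)" if "w \<in> lists {1..n}" "v \<in> lists {1..l}" for w v
      using X Y that by (simp add: G_def admissible_def)
  qed
  have "(\<lambda>p. norm (F p)) summable_on (lists {1..n} \<times> lists {1..l})"
  proof (rule Infinite_Sum.abs_summable_on_comparison_test')
    show "(\<lambda>p. norm Z / 2 * (G x p + G y p)) summable_on (lists {1..n} \<times> lists {1..l})"
      by (intro summable_on_cmult_right summable_on_add G)
    fix p assume "p \<in> lists {1..n} \<times> lists {1..l}"
    then obtain w v where p: "p = (w, v)" "w \<in> lists {1..n}" "v \<in> lists {1..l}" by auto
    then have ab: "0 \<le> a w" "0 \<le> b v" using X Y by (auto simp: admissible_def)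
    have "a w * (b v * cmod (cinner (app Z (V v (U w x))) (V v (U w y)))) \<le>
      a w * (b v * (norm Z * ((norm (V v (U w x)))\<^sup>2 + (norm (V v (U w y)))\<^sup>2) / 2))"
      using ab by (intro mult_left_mono cmod_cinner_app_le)
    then show "norm (F p) \<le> norm Z / 2 * (G x p + G y p)"
      using ab by (simp add: p F_def G_def norm_mult algebra_simps)
  qed
  then have "F summable_on (lists {1..n} \<times> lists {1..l})" by (rule Infinite_Sum.abs_summable_summable)
  then obtain S where S: "(F has_sum S) (lists {1..n} \<times> lists {1..l})"
    by (auto simp: summable_on_def)
  have "S = cinner (app (Phi n a X (Phi l b Y Z)) x) y"
    using has_sum_SigmaD[OF S inner] outer has_sum_unique by blast
  moreover have "S = cinner (app (Phi l b Y (Phi n a X Z)) x) y"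
  proof -
    have "((\<lambda>(v, w). F (w, v)) has_sum S) (lists {1..l} \<times> lists {1..n})"
      using S by (subst (asm) has_sum_swap)
    from has_sum_SigmaD[OF this] inner' outer' show ?thesis using has_sum_unique by fastforce
  qed
  ultimately show "cinner (app (Phi n a X (Phi l b Y Z)) x) y = cinner (app (Phi l b Y (Phi n a X Z)) x) y"
    by simp
qed

lemma word_op_similar:
  assumes inv: "C * D = 1" "D * C = 1" and X': "\<And>j. j \<in> J \<Longrightarrow> X' j = C * X j * D"
    and w: "w \<in> lists J"
  shows "word_op X' w = C * word_op X w * D"
  using w
proof (induction w)
  case (Cons j w)
  have "word_op X' (j # w) = X' j * word_op X' w" by simp
  also have "\<dots> = C * X j * (D * C) * word_op X w * D"
    using Cons X'[of j] by (simp add: mult.assoc)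
  finally show ?case by (simp add: inv mult.assoc)
qed (simp add: inv)

text \<open>D is the inverse of C and in general not its adjoint, so the adjoint word supplies adj D
  and adj C; hence the inner argument is D Y D^* and not D Y C.\<close>

lemma similar_has_wot_sum:
  assumes inv: "C * D = 1" "D * C = 1" and X': "\<And>j. j \<in> {1..n} \<Longrightarrow> X' j = C * X j * D"
    and adm: "admissible n a X"
  shows "has_wot_sum (\<lambda>w. a w *\<^sub>R (word_op X' w * Y * adj (word_op X' w)))
    (C * Phi n a X (D * Y * adj D) * adj C) (lists {1..n})"
proof -
  have word: "word_op X' w = C * word_op X w * D" if "w \<in> lists {1..n}" for w
    by (rule word_op_similar[OF inv _ that]) (rule X')
  have "has_wot_sum (\<lambda>w. C * (a w *\<^sub>R (word_op X w * (D * Y * adj D) * adj (word_op X w))) * adj C)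
    (C * Phi n a X (D * Y * adj D) * adj C) (lists {1..n})"
    by (intro has_wot_sum_conj Phi_has_wot_sum adm)
  then show ?thesis
    by (rule has_wot_sum_cong[THEN iffD1, rotated])
      (simp add: word adj_times mult.assoc del: One_nat_def)
qed

lemma similar_admissible:
  assumes inv: "C * D = 1" "D * C = 1" and X': "\<And>j. j \<in> {1..n} \<Longrightarrow> X' j = C * X j * D"
    and adm: "admissible n a X"
  shows "admissible n a X'"
proof -
  have "has_wot_sum (\<lambda>w. a w *\<^sub>R (word_op X' w * 1 * adj (word_op X' w)))
    (C * Phi n a X (D * 1 * adj D) * adj C) (lists {1..n})"
    by (rule similar_has_wot_sum) (use assms in auto)
  then show ?thesis
    using adm by (auto simp: admissible_def Phi_well_defined_def)
qed

lemma Phi_similar: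
  assumes inv: "C * D = 1" "D * C = 1" and X': "\<And>j. j \<in> {1..n} \<Longrightarrow> X' j = C * X j * D"
    and adm: "admissible n a X"
  shows "Phi n a X' Y = C * Phi n a X (D * Y * adj D) * adj C"
  by (intro Phi_eqI similar_has_wot_sum) (use assms in auto)

section \<open>Submultiplicative sequences\<close>

text \<open>Write s = q N + r: the q blocks contribute powers of c N, and the finitely many
  remainders cost only a constant.\<close>

lemma submultiplicative_eventually_le:
  fixes c :: "nat \<Rightarrow> real"
  assumes nonneg: "\<And>s. 0 \<le> c s" and sub: "\<And>s t. c (s + t) \<le> c s * c t"
    and N: "1 \<le> N" "c N < \<rho> ^ N" and \<rho>: "0 < \<rho>"
  shows "\<forall>\<^sub>F s in sequentially. c s \<le> \<rho> ^ s"
proof -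
  \<comment> \<open>A rate strictly below \<rho>, leaving room for the constant; the entry \<rho> /
    2 keeps it positive when c N = 0.\<close>
  define \<sigma> where "\<sigma> = max (\<rho> / 2) (root N (c N))"
  have "root N (c N) < root N (\<rho> ^ N)" using N by (intro real_root_less_mono) simp_all
  then have \<sigma>: "0 < \<sigma>" "\<sigma> < \<rho>" using N \<rho> by (simp_all add: \<sigma>_def real_root_power_cancel)
  have "c N = root N (c N) ^ N" using N nonneg by (simp add: real_root_pow_pos2)
  also have "\<dots> \<le> \<sigma> ^ N" using nonneg by (intro power_mono) (simp_all add: \<sigma>_def real_root_ge_zero)
  finally have cN: "c N \<le> \<sigma> ^ N" .
  have block: "c (q * N + r) \<le> (\<sigma> ^ N) ^ q * c r" for q r
  proof (induction q)
    case (Suc q)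
    have "c (Suc q * N + r) \<le> c N * c (q * N + r)" using sub[of N "q * N + r"] by (simp add: add.assoc)
    also have "\<dots> \<le> \<sigma> ^ N * ((\<sigma> ^ N) ^ q * c r)"
      using cN Suc nonneg \<sigma> by (intro mult_mono) simp_all
    finally show ?case by (simp add: mult.assoc)
  qed simp
  define K where "K = (\<Sum>r<N. c r / \<sigma> ^ r)"
  have le: "c s \<le> K * \<sigma> ^ s" for s
  proof -
    let ?r = "s mod N"
    have r: "?r < N" using N by simp
    have "c s \<le> (\<sigma> ^ N) ^ (s div N) * c ?r" using block[of "s div N" ?r] by simp
    also have "\<dots> = \<sigma> ^ s * (c ?r / \<sigma> ^ ?r)"
    proof -
      have "\<sigma> ^ s = (\<sigma> ^ N) ^ (s div N) * \<sigma> ^ ?r"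
        by (simp add: power_mult[symmetric] power_add[symmetric])
      then show ?thesis using \<sigma> by simp
    qed
    also have "c ?r / \<sigma> ^ ?r \<le> K"
      unfolding K_def using r nonneg \<sigma> by (intro member_le_sum) simp_all
    finally show ?thesis using \<sigma> by (simp add: mult.commute)
  qed
  \<comment> \<open>The gap between \<sigma> and \<rho> eventually swallows
    \<open>K\<close>.\<close>
  have "(\<lambda>s. K * (\<sigma> / \<rho>) ^ s) \<longlonglongrightarrow> K * 0"
    using \<sigma> by (intro tendsto_mult tendsto_const LIMSEQ_power_zero) simp
  then have "\<forall>\<^sub>F s in sequentially. K * (\<sigma> / \<rho>) ^ s < 1"
    by (rule order_tendstoD(2)) simp
  then show ?thesis
  proof eventually_elim
    case (elim s)
    have "K * \<sigma> ^ s = K * (\<sigma> / \<rho>) ^ s * \<rho> ^ s" using \<rho> by (simp add: power_divide)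
    also have "\<dots> < 1 * \<rho> ^ s" using elim \<rho> by (intro mult_strict_right_mono) simp_all
    finally have "K * \<sigma> ^ s < \<rho> ^ s" by simp
    then show ?case using le[of s] by simp
  qed
qed

text \<open>Translates between the 2s-th roots of the spectral radius formula and geometric bounds,
  with b^2 as the rate. The index 0 is excluded since there the exponent reads 1 / 0 = 0.\<close>

lemma powr_root_less_iff:
  assumes "0 \<le> c" "0 < b" "1 \<le> (s::nat)"
  shows "c powr (1 / (2 * real s)) < b \<longleftrightarrow> c < (b\<^sup>2) ^ s"
proof (cases "c = 0")
  case False
  have "(b\<^sup>2) ^ s = b powr (2 * real s)"
    using powr_realpow[OF assms(2), of "2 * s"] by (simp add: power_mult)
  moreover have "(c powr (1 / (2 * real s))) powr (2 * real s) = c"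
    using assms False by (simp add: powr_powr)
  moreover have "c powr (1 / (2 * real s)) < b \<longleftrightarrow>
      (c powr (1 / (2 * real s))) powr (2 * real s) < b powr (2 * real s)"
    using assms False powr_less_mono2[of "2 * real s" "c powr (1 / (2 * real s))" b]
      powr_less_cancel2[of "2 * real s" "c powr (1 / (2 * real s))" b] by auto
  ultimately show ?thesis by simp
qed (use assms in simp)

text \<open>The limit is the infimum of the roots over s \<ge> 1. Existence has to be proved because
  \<open>joint_spectral_radius\<close> is defined through \<open>lim\<close>.\<close>

lemma submultiplicative_root_limit:
  fixes c :: "nat \<Rightarrow> real"
  assumes nonneg: "\<And>s. 0 \<le> c s" and sub: "\<And>s t. c (s + t) \<le> c s * c t"
  shows "convergent (\<lambda>s. c s powr (1 / (2 * real s)))"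
proof -
  define u where "u s = c s powr (1 / (2 * real s))" for s
  define L where "L = (INF s\<in>{1..}. u s)"
  have bdd: "bdd_below (u ` {1..})" by (rule bdd_belowI[of _ 0]) (auto simp: u_def)
  have L_le: "L \<le> u s" if "1 \<le> s" for s
    unfolding L_def using that by (intro cINF_lower bdd) simp
  have "u \<longlonglongrightarrow> L"
  proof (rule order_tendstoI)
    fix b assume "b < L"
    show "\<forall>\<^sub>F s in sequentially. b < u s"
      using eventually_ge_at_top[of "1::nat"]
    proof eventually_elim
      case (elim s)
      show ?case using L_le[OF elim] \<open>b < L\<close> by simp
    qed
  next
    fix b assume "L < b"
    then obtain N where N: "1 \<le> N" "u N < b"
      using cInf_lessD[of "u ` {1..}" b] unfolding L_def by auto
    \<comment> \<open>An intermediate rate turns the weak inequality supplied by submultiplicativity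
      into a strict one.\<close>
    then obtain d where d: "u N < d" "d < b" using dense by blast
    have "0 \<le> u N" by (simp add: u_def)
    with d have d0: "0 < d" by linarith
    have "\<forall>\<^sub>F s in sequentially. c s \<le> (d\<^sup>2) ^ s"
      using N d d0 nonneg powr_root_less_iff[of "c N" d N]
      by (intro submultiplicative_eventually_le[OF nonneg sub N(1)]) (simp_all add: u_def)
    with eventually_ge_at_top[of "1::nat"] show "\<forall>\<^sub>F s in sequentially. u s < b"
    proof eventually_elim
      case (elim s)
      have "(d\<^sup>2) ^ s < (b\<^sup>2) ^ s"
        using elim d d0 by (intro power_strict_mono) simp_all
      then show ?case
        using elim d d0 nonneg powr_root_less_iff[of "c s" b s] by (simp add: u_def)
    qed
  qed
  then show ?thesis unfolding u_def convergent_def by blast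
qed

definition geometric_decay :: "(nat \<Rightarrow> real) \<Rightarrow> bool" where
  "geometric_decay c \<longleftrightarrow> (\<exists>\<rho>. 0 < \<rho> \<and> \<rho> < 1 \<and> (\<forall>\<^sub>F s in sequentially. c s \<le> \<rho> ^ s))"

lemma geometric_decay_iff_tendsto_0:
  fixes c :: "nat \<Rightarrow> real"
  assumes nonneg: "\<And>s. 0 \<le> c s" and sub: "\<And>s t. c (s + t) \<le> c s * c t"
  shows "geometric_decay c \<longleftrightarrow> c \<longlonglongrightarrow> 0"
proof
  assume "geometric_decay c"
  then obtain \<rho> where \<rho>: "0 < \<rho>" "\<rho> < 1" "\<forall>\<^sub>F s in sequentially. c s \<le> \<rho> ^ s"
    by (auto simp: geometric_decay_def)
  show "c \<longlonglongrightarrow> 0"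
  proof (rule tendsto_sandwich[OF _ \<rho>(3) tendsto_const])
    show "(\<lambda>s. \<rho> ^ s) \<longlonglongrightarrow> 0" using \<rho> by (intro LIMSEQ_power_zero) simp
  qed (simp add: nonneg)
next
  assume "c \<longlonglongrightarrow> 0"
  then have "\<forall>\<^sub>F s in sequentially. c s < 1" by (rule order_tendstoD(2)) simp
  then obtain N where "\<forall>s\<ge>N. c s < 1" by (auto simp: eventually_sequentially)
  then have N: "c (Suc N) < 1" by simp
  \<comment> \<open>Chosen so that its power of order \<open>Suc N\<close> is the midpoint between
    \<open>c (Suc N)\<close> and 1.\<close>
  let ?\<rho> = "root (Suc N) ((c (Suc N) + 1) / 2)"
  have c0: "0 \<le> c (Suc N)" by (rule nonneg)
  have lt: "c (Suc N) < ?\<rho> ^ Suc N" using N c0 by (subst real_root_pow_pos2) simp_all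
  have pos: "0 < ?\<rho>" using c0 by (subst real_root_gt_0_iff) simp_all
  have "?\<rho> < 1" using N by (subst real_root_lt_1_iff) simp_all
  moreover have "\<forall>\<^sub>F s in sequentially. c s \<le> ?\<rho> ^ s"
    using lt pos by (intro submultiplicative_eventually_le[OF nonneg sub, of "Suc N"]) simp_all
  ultimately show "geometric_decay c"
    unfolding geometric_decay_def using pos by blast
qed

lemma geometric_decay_iff_root_limit:
  fixes c :: "nat \<Rightarrow> real"
  assumes nonneg: "\<And>s. 0 \<le> c s" and sub: "\<And>s t. c (s + t) \<le> c s * c t"
  shows "geometric_decay c \<longleftrightarrow> lim (\<lambda>s. c s powr (1 / (2 * real s))) < 1"
proof -
  define u where "u s = c s powr (1 / (2 * real s))" for s
  have lim: "u \<longlonglongrightarrow> lim u"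
    using submultiplicative_root_limit[OF nonneg sub] unfolding u_def
    by (simp add: convergent_LIMSEQ_iff)
  have "geometric_decay c \<longleftrightarrow> lim u < 1"
  proof
    assume "geometric_decay c"
    then obtain \<rho> where \<rho>: "0 < \<rho>" "\<rho> < 1" "\<forall>\<^sub>F s in sequentially. c s \<le> \<rho> ^ s"
      by (auto simp: geometric_decay_def)
    \<comment> \<open>The root criterion needs a strict bound, hence d > \<rho>; roots have order
      2s, hence the limit is compared with sqrt d.\<close>
    obtain d where d: "\<rho> < d" "d < 1" using dense \<rho>(2) by blast
    have "lim u \<le> sqrt d"
    proof (rule tendsto_upperbound[OF lim])
      show "\<forall>\<^sub>F s in sequentially. u s \<le> sqrt d"
        using \<rho>(3) eventually_ge_at_top[of "1::nat"]
      proof eventually_elim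
        case (elim s)
        have "\<rho> ^ s < d ^ s" using elim \<rho> d by (intro power_strict_mono) simp_all
        then have "u s < sqrt d"
          using elim \<rho> d nonneg powr_root_less_iff[of "c s" "sqrt d" s] by (simp add: u_def)
        then show ?case by simp
      qed
    qed simp
    also have "sqrt d < 1" using d \<rho> by simp
    finally show "lim u < 1" .
  next
    assume less: "lim u < 1"
    have "0 \<le> lim u" by (rule tendsto_lowerbound[OF lim]) (simp_all add: u_def)
    then obtain b where b: "lim u < b" "b < 1" "0 < b"
      using dense[OF less] by force
    have "\<forall>\<^sub>F s in sequentially. u s < b" using lim b(1) by (rule order_tendstoD(2))
    with eventually_ge_at_top[of "1::nat"] have "\<forall>\<^sub>F s in sequentially. c s \<le> (b\<^sup>2) ^ s"
    proof eventually_elim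
      case (elim s)
      then show ?case using b nonneg powr_root_less_iff[of "c s" b s] by (simp add: u_def)
    qed
    moreover have "b\<^sup>2 < 1" using b by (simp add: power_less_one_iff)
    ultimately show "geometric_decay c" unfolding geometric_decay_def using b
      by (intro exI[of _ "b\<^sup>2"]) simp
  qed
  then show ?thesis by (simp add: u_def[abs_def])
qed

text \<open>The Cauchy product with the geometric series raises j by one, by the hockey-stick
  identity.\<close>

lemma summable_binomial_power:
  fixes r :: real
  assumes "0 \<le> r" "r < 1"
  shows "summable (\<lambda>s. real ((s + j) choose j) * r ^ s)"
proof (induction j)
  case (Suc j)
  have "summable (\<lambda>k. \<Sum>i\<le>k. (real ((i + j) choose j) * r ^ i) * r ^ (k - i))"
    using Suc assms by (intro summable_Cauchy_product) (simp_all add: summable_geometric)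
  moreover have "(\<Sum>i\<le>k. (real ((i + j) choose j) * r ^ i) * r ^ (k - i)) =
      real ((k + Suc j) choose Suc j) * r ^ k" for k
  proof -
    have "(\<Sum>i\<le>k. (real ((i + j) choose j) * r ^ i) * r ^ (k - i)) = (\<Sum>i\<le>k. real ((j + i) choose j) * r ^ k)"
      by (intro sum.cong) (simp_all add: mult.assoc power_add[symmetric] add.commute)
    also have "\<dots> = real (\<Sum>i\<le>k. (j + i) choose j) * r ^ k" by (simp add: sum_distrib_right)
    also have "\<dots> = real ((k + Suc j) choose Suc j) * r ^ k"
      by (subst choose_rising_sum(1)) (simp add: add.commute)
    finally show ?thesis .
  qed
  ultimately show ?case by simp
qed (use assms in \<open>simp add: summable_geometric\<close>)

lemma geometric_decay_summable:
  fixes c :: "nat \<Rightarrow> real"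
  assumes "geometric_decay c" and nonneg: "\<And>s. 0 \<le> c s"
  shows "summable (\<lambda>s. real ((s + j) choose j) * c s)"
proof -
  obtain \<rho> where \<rho>: "0 < \<rho>" "\<rho> < 1" "\<forall>\<^sub>F s in sequentially. c s \<le> \<rho> ^ s"
    using assms(1) by (auto simp: geometric_decay_def)
  show ?thesis
  proof (rule summable_comparison_test_ev)
    show "summable (\<lambda>s. real ((s + j) choose j) * \<rho> ^ s)"
      using \<rho> by (intro summable_binomial_power) simp_all
    show "\<forall>\<^sub>F s in sequentially. norm (real ((s + j) choose j) * c s) \<le> real ((s + j) choose j) * \<rho> ^ s"
      using \<rho>(3) by eventually_elim (simp add: abs_mult nonneg mult_left_mono)
  qed
qed

section \<open>Resolvents of positive maps\<close>

text \<open>A stand-in for complete positivity that is visibly closed under composition. Its last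
  clause, applied to \<open>dominated (norm Z) Z 1\<close>, gives norm (\<phi> Z) \<le> norm (\<phi>
  1) * norm Z.\<close>

definition dominating_map :: "('h::complex_hilbert bop \<Rightarrow> 'h bop) \<Rightarrow> bool" where
  "dominating_map \<phi> \<longleftrightarrow>
     (\<forall>S T. \<phi> (S + T) = \<phi> S + \<phi> T) \<and> (\<forall>r S. \<phi> (r *\<^sub>R S) = r *\<^sub>R \<phi> S) \<and>
     (\<forall>P. positive_op P \<longrightarrow> positive_op (\<phi> P)) \<and>
     (\<forall>K Z P. dominated K Z P \<longrightarrow> dominated K (\<phi> Z) (\<phi> P))"

lemma dominating_map_funpow: "dominating_map \<phi> \<Longrightarrow> dominating_map (\<phi> ^^ s)"
  by (induction s) (simp_all add: dominating_map_def)

lemma dominating_map_Phi: "admissible n a X \<Longrightarrow> dominating_map (Phi n a X)"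
  by (simp add: dominating_map_def Phi_add Phi_scaleR Phi_positive Phi_dominated)

lemma dominating_map_norm_le:
  assumes "dominating_map \<phi>" shows "norm (\<phi> Z) \<le> norm (\<phi> 1) * norm Z"
proof -
  have "dominated (norm Z) (\<phi> Z) (\<phi> 1)"
    using assms dominated_one[of Z] by (simp add: dominating_map_def)
  then show ?thesis using dominated_norm[of "norm Z" "\<phi> Z" "\<phi> 1"] by (simp add: mult.commute)
qed

lemma dominating_map_bounded_linear:
  assumes "dominating_map \<phi>" shows "bounded_linear \<phi>"
  by (rule bounded_linear_intro[where K = "norm (\<phi> 1)"])
    (use assms dominating_map_norm_le[OF assms] in \<open>simp_all add: dominating_map_def mult.commute\<close>)

lemma dominating_map_diff: "dominating_map \<phi> \<Longrightarrow> \<phi> (S - T) = \<phi> S - \<phi> T"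
  using linear_diff[OF bounded_linear.linear[OF dominating_map_bounded_linear]] .

lemma dominating_map_scaleR: "dominating_map \<phi> \<Longrightarrow> \<phi> (r *\<^sub>R T) = r *\<^sub>R \<phi> T"
  by (simp add: dominating_map_def)

lemma dominating_map_positive: "dominating_map \<phi> \<Longrightarrow> positive_op P \<Longrightarrow> positive_op (\<phi> P)"
  by (simp add: dominating_map_def)

lemma funpow_commute:
  assumes "\<And>x. f (g x) = g (f x)" shows "(f ^^ s) (g x) = g ((f ^^ s) x)"
  by (induction s) (simp_all add: assms)

definition power_norm :: "('h::complex_hilbert bop \<Rightarrow> 'h bop) \<Rightarrow> nat \<Rightarrow> real" where
  "power_norm \<phi> s = norm ((\<phi> ^^ s) 1)"

lemma power_norm_nonneg [simp]: "0 \<le> power_norm \<phi> s" by (simp add: power_norm_def)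

lemma norm_funpow_le:
  "dominating_map \<phi> \<Longrightarrow> norm ((\<phi> ^^ s) Z) \<le> power_norm \<phi> s * norm Z"
  unfolding power_norm_def by (intro dominating_map_norm_le dominating_map_funpow)

lemma power_norm_submult:
  assumes "dominating_map \<phi>" shows "power_norm \<phi> (s + t) \<le> power_norm \<phi> s * power_norm \<phi> t"
  using norm_funpow_le[OF assms, of s "(\<phi> ^^ t) 1"] by (simp add: power_norm_def funpow_add)

text \<open>\<open>binomial_resolvent \<phi> m\<close> is the inverse of \<open>(id - \<phi>) ^ m\<close>; the case \<open>m = 0\<close> is separated
  because \<open>m - 1\<close> is truncated.\<close>

definition binomial_resolvent :: "('h::complex_hilbert bop \<Rightarrow> 'h bop) \<Rightarrow> nat \<Rightarrow> 'h bop \<Rightarrow> 'h bop" where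
  "binomial_resolvent \<phi> m Y =
     (if m = 0 then Y else suminf (\<lambda>s. real ((s + m - 1) choose (m - 1)) *\<^sub>R (\<phi> ^^ s) Y))"

context
  fixes \<phi> :: "'h::complex_hilbert bop \<Rightarrow> 'h bop"
  assumes dom: "dominating_map \<phi>" and decay: "geometric_decay (power_norm \<phi>)"
begin

lemma binomial_resolvent_summable_norm:
  "summable (\<lambda>s. norm (real ((s + j) choose j) *\<^sub>R (\<phi> ^^ s) Y))"
proof (rule summable_comparison_test')
  show "summable (\<lambda>s. (real ((s + j) choose j) * power_norm \<phi> s) * norm Y)"
    by (intro summable_mult2 geometric_decay_summable decay) simp
  show "norm (norm (real ((s + j) choose j) *\<^sub>R (\<phi> ^^ s) Y)) \<le> real ((s + j) choose j) * power_norm \<phi> s * norm Y" for s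
    using mult_left_mono[OF norm_funpow_le[OF dom, of s Y], of "real ((s + j) choose j)"]
    by (simp add: mult.assoc)
qed

lemma binomial_resolvent_sums:
  "(\<lambda>s. real ((s + j) choose j) *\<^sub>R (\<phi> ^^ s) Y) sums binomial_resolvent \<phi> (Suc j) Y"
  using summable_sums[OF summable_norm_cancel[OF binomial_resolvent_summable_norm]]
  by (simp add: binomial_resolvent_def)

lemma binomial_resolvent_has_sum:
  assumes "1 \<le> m"
  shows "((\<lambda>s. real ((s + m - 1) choose (m - 1)) *\<^sub>R (\<phi> ^^ s) Y) has_sum binomial_resolvent \<phi> m Y) UNIV"
proof -
  obtain j where m: "m = Suc j" using assms by (cases m) auto
  show ?thesis
    unfolding m using norm_summable_imp_has_sum[OF binomial_resolvent_summable_norm binomial_resolvent_sums]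
    by simp
qed

text \<open>Pascal's rule: subtracting the shifted series replaces the weight (s + m) choose m by (s
  + m - 1) choose (m - 1).\<close>

lemma binomial_resolvent_Suc:
  "binomial_resolvent \<phi> (Suc m) Y - \<phi> (binomial_resolvent \<phi> (Suc m) Y) = binomial_resolvent \<phi> m Y"
proof -
  define f where "f s = real ((s + m) choose m) *\<^sub>R (\<phi> ^^ s) Y" for s
  define N where "N = binomial_resolvent \<phi> (Suc m) Y"
  have f: "f sums N" unfolding f_def[abs_def] N_def by (rule binomial_resolvent_sums)
  \<comment> \<open>The image series under \<phi>, shifted by one so that equal powers of \<phi>
    share an index.\<close>
  define g where "g s = (case s of 0 \<Rightarrow> 0 | Suc s \<Rightarrow> \<phi> (f s))" for s
  have "(\<lambda>s. g (Suc s)) sums \<phi> N"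
    unfolding g_def using bounded_linear.sums[OF dominating_map_bounded_linear[OF dom] f] by simp
  then have "g sums (\<phi> N + g 0)" by (rule sums_Suc)
  then have "g sums \<phi> N" by (simp add: g_def)
  with f have diff: "(\<lambda>s. f s - g s) sums (N - \<phi> N)" by (rule sums_diff)
  have g_0: "g 0 = 0" by (simp add: g_def)
  have g_Suc: "g (Suc s) = real ((s + m) choose m) *\<^sub>R (\<phi> ^^ Suc s) Y" for s
    by (simp add: g_def f_def dominating_map_scaleR[OF dom])
  have "N - \<phi> N = binomial_resolvent \<phi> m Y"
  proof (cases m)
    case 0
    \<comment> \<open>All weights equal 1 here, so the difference telescopes to the term at s =
      0.\<close>
    have "f s - g s = (if s = 0 then Y else 0)" for s
      by (cases s) (simp_all add: f_def g_0 g_Suc 0)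
    then have "(\<lambda>s. if s = 0 then Y else 0) sums (N - \<phi> N)" using diff by simp
    then have "N - \<phi> N = Y" using sums_single[of 0 "\<lambda>_. Y"] sums_unique2 by blast
    then show ?thesis by (simp add: 0 binomial_resolvent_def)
  next
    case (Suc j)
    have "f s - g s = real ((s + j) choose j) *\<^sub>R (\<phi> ^^ s) Y" for s
      by (cases s) (simp_all add: f_def g_0 g_Suc Suc scaleR_left_distrib)
    then show ?thesis using diff binomial_resolvent_sums[of j Y] sums_unique2 unfolding Suc by simp
  qed
  then show ?thesis by (simp add: N_def)
qed

lemma funpow_defect_binomial_resolvent:
  "p \<le> m \<Longrightarrow> ((\<lambda>Y. Y - \<phi> Y) ^^ p) (binomial_resolvent \<phi> m Y) = binomial_resolvent \<phi> (m - p) Y"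
proof (induction p)
  case (Suc p)
  then have "m - p = Suc (m - Suc p)" by simp
  with Suc show ?case by (simp add: binomial_resolvent_Suc)
qed simp

lemma binomial_resolvent_positive:
  assumes "positive_op Y" shows "positive_op (binomial_resolvent \<phi> m Y)"
proof (cases m)
  case (Suc j)
  have "positive_op ((\<phi> ^^ s) Y)" for s
    by (rule dominating_map_positive[OF dominating_map_funpow[OF dom] assms])
  then show ?thesis unfolding Suc
    by (intro positive_op_sums[OF binomial_resolvent_sums] positive_op_scaleR) simp_all
qed (simp add: binomial_resolvent_def assms)

lemma binomial_resolvent_diff:
  "binomial_resolvent \<phi> m (Y - Z) = binomial_resolvent \<phi> m Y - binomial_resolvent \<phi> m Z"
proof (cases m)
  case (Suc j)
  have "(\<lambda>s. real ((s + j) choose j) *\<^sub>R (\<phi> ^^ s) Y - real ((s + j) choose j) *\<^sub>R (\<phi> ^^ s) Z)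
      sums (binomial_resolvent \<phi> m Y - binomial_resolvent \<phi> m Z)"
    unfolding Suc by (rule sums_diff[OF binomial_resolvent_sums binomial_resolvent_sums])
  moreover have "(\<phi> ^^ s) (Y - Z) = (\<phi> ^^ s) Y - (\<phi> ^^ s) Z" for s
    by (rule dominating_map_diff[OF dominating_map_funpow[OF dom]])
  ultimately show ?thesis
    unfolding Suc using binomial_resolvent_sums[of j "Y - Z"] sums_unique2
    by (simp add: scaleR_diff_right)
qed (simp add: binomial_resolvent_def)

lemma binomial_resolvent_commute:
  assumes \<psi>: "dominating_map \<psi>" and comm: "\<And>Y. \<phi> (\<psi> Y) = \<psi> (\<phi> Y)"
  shows "\<psi> (binomial_resolvent \<phi> m Y) = binomial_resolvent \<phi> m (\<psi> Y)"
proof (cases m)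
  case (Suc j)
  have "(\<lambda>s. \<psi> (real ((s + j) choose j) *\<^sub>R (\<phi> ^^ s) Y)) sums \<psi> (binomial_resolvent \<phi> m Y)"
    unfolding Suc by (intro bounded_linear.sums[OF dominating_map_bounded_linear[OF \<psi>]] binomial_resolvent_sums)
  moreover have "\<psi> (real ((s + j) choose j) *\<^sub>R (\<phi> ^^ s) Y) = real ((s + j) choose j) *\<^sub>R (\<phi> ^^ s) (\<psi> Y)" for s
    by (simp add: dominating_map_scaleR[OF \<psi>] funpow_commute[of \<phi> \<psi>, OF comm])
  ultimately show ?thesis
    unfolding Suc using binomial_resolvent_sums[of j "\<psi> Y"] sums_unique2 by simp
qed (simp add: binomial_resolvent_def)

text \<open>The difference of two preimages is a fixed point of \<phi>, hence of every power of
  \<phi>, and those powers tend to 0 in norm. Uniqueness of the solution rests on this.\<close>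

lemma defect_inj: "inj (\<lambda>Y. Y - \<phi> Y)"
proof (rule injI)
  fix Y Z assume eq: "Y - \<phi> Y = Z - \<phi> Z"
  define D where "D = Y - Z"
  have fixed: "\<phi> D = D" using eq by (simp add: D_def dominating_map_diff[OF dom] algebra_simps)
  have "(\<phi> ^^ s) D = D" for s by (induction s) (simp_all add: fixed)
  then have le: "norm D \<le> power_norm \<phi> s * norm D" for s using norm_funpow_le[OF dom, of s D] by simp
  have "power_norm \<phi> \<longlonglongrightarrow> 0"
    using geometric_decay_iff_tendsto_0[of "power_norm \<phi>"] decay power_norm_submult[OF dom] by simp
  then have "(\<lambda>s. power_norm \<phi> s * norm D) \<longlonglongrightarrow> 0 * norm D" by (intro tendsto_intros)
  then have "norm D \<le> 0 * norm D"
    by (rule tendsto_lowerbound) (simp_all add: le)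
  then show "Y = Z" by (simp add: D_def)
qed

end

section \<open>Compositions of indexed families of maps\<close>

lemma comp_upto_0 [simp]: "comp_upto 0 F = id"
  by (simp add: comp_upto_def)

lemma comp_upto_Suc [simp]: "comp_upto (Suc k) F = comp_upto k F \<circ> F (Suc k)"
proof -
  have "foldr (\<circ>) Fs g = foldr (\<circ>) Fs id \<circ> g" for Fs :: "('b \<Rightarrow> 'b) list" and g
    by (induction Fs) (simp_all add: comp_assoc)
  then have "foldr (\<circ>) (map F [1..<Suc k]) (F (Suc k)) = foldr (\<circ>) (map F [1..<Suc k]) id \<circ> F (Suc k)"
    by blast
  then show ?thesis by (simp add: comp_upto_def)
qed

lemma comp_upto_cong: "(\<And>i. i \<in> {1..k} \<Longrightarrow> F i = G i) \<Longrightarrow> comp_upto k F = comp_upto k G"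
  by (induction k) simp_all

lemma comp_upto_invariant:
  "(\<And>i x. i \<in> {1..k} \<Longrightarrow> P x \<Longrightarrow> P (F i x)) \<Longrightarrow> P x \<Longrightarrow> P (comp_upto k F x)"
  by (induction k arbitrary: x) simp_all

lemma comp_upto_intertwine:
  "(\<And>i x. i \<in> {1..k} \<Longrightarrow> g (F i x) = G i (g x)) \<Longrightarrow> g (comp_upto k F x) = comp_upto k G (g x)"
  by (induction k arbitrary: x) simp_all

lemma comp_upto_inj: "(\<And>i. i \<in> {1..k} \<Longrightarrow> inj (F i)) \<Longrightarrow> inj (comp_upto k F)"
  by (induction k) (simp_all add: inj_compose)

text \<open>Only maps with different indices need to commute: each \<open>F i\<close> moves past the
  foreign factors until it meets its own \<open>G i\<close>.\<close>

lemma comp_upto_comp: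
  assumes "\<And>i j x. i \<in> {1..k} \<Longrightarrow> j \<in> {1..k} \<Longrightarrow> i \<noteq> j \<Longrightarrow> F i (G j x) = G j (F i x)"
  shows "comp_upto k F (comp_upto k G x) = comp_upto k (\<lambda>i. F i \<circ> G i) x"
  using assms
proof (induction k arbitrary: x)
  case (Suc k)
  have "F (Suc k) (comp_upto k G y) = comp_upto k G (F (Suc k) y)" for y
    by (rule comp_upto_intertwine) (use Suc.prems in auto)
  then show ?case using Suc by simp
qed simp

text \<open>Presents a single map as a family, so that \<open>comp_upto_comp\<close> can merge it
  into one exponent of a composite.\<close>

lemma comp_upto_single: "i \<in> {1..k} \<Longrightarrow> comp_upto k (\<lambda>j. if j = i then f else id) = f"
proof (induction k)
  case (Suc k)
  show ?case
  proof (cases "i = Suc k")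
    case True
    have "comp_upto k (\<lambda>j. if j = i then f else id) = comp_upto k (\<lambda>j. id)"
      by (rule comp_upto_cong) (use True in auto)
    moreover have "comp_upto k (\<lambda>j. id) = (id :: 'a \<Rightarrow> 'a)" by (induction k) simp_all
    ultimately show ?thesis using True by simp
  qed (use Suc in auto)
qed simp

section \<open>Commuting families\<close>

definition multi_defect ::
    "nat \<Rightarrow> (nat \<Rightarrow> 'h::complex_hilbert bop \<Rightarrow> 'h bop) \<Rightarrow> (nat \<Rightarrow> nat) \<Rightarrow> 'h bop \<Rightarrow> 'h bop" where
  "multi_defect k \<phi> p = comp_upto k (\<lambda>i. (\<lambda>Y. Y - \<phi> i Y) ^^ p i)"

locale commuting_maps =
  fixes k :: nat and \<phi> :: "nat \<Rightarrow> 'h::complex_hilbert bop \<Rightarrow> 'h bop"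
  assumes dom: "i \<in> {1..k} \<Longrightarrow> dominating_map (\<phi> i)"
    and comm: "i \<in> {1..k} \<Longrightarrow> j \<in> {1..k} \<Longrightarrow> \<phi> i (\<phi> j Y) = \<phi> j (\<phi> i Y)"
begin

abbreviation "defect i Y \<equiv> Y - \<phi> i Y"

lemma defect_commute:
  "i \<in> {1..k} \<Longrightarrow> j \<in> {1..k} \<Longrightarrow> defect i (defect j Y) = defect j (defect i Y)"
  by (simp add: dominating_map_diff[OF dom] comm[of i j] del: One_nat_def)

lemma multi_defect_zero: "(\<And>i. i \<in> {1..k} \<Longrightarrow> p i = 0) \<Longrightarrow> multi_defect k \<phi> p Y = Y"
  unfolding multi_defect_def by (rule comp_upto_invariant[where P = "\<lambda>X. X = Y"]) auto

lemma multi_defect_cong: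
  "(\<And>i. i \<in> {1..k} \<Longrightarrow> p i = q i) \<Longrightarrow> multi_defect k \<phi> p = multi_defect k \<phi> q"
  unfolding multi_defect_def by (rule comp_upto_cong) simp

lemma multi_defect_Suc:
  assumes i: "i \<in> {1..k}"
  shows "multi_defect k \<phi> (p(i := Suc (p i))) Y = defect i (multi_defect k \<phi> p Y)"
proof -
  let ?D = "\<lambda>j. (\<lambda>Y. Y - \<phi> j Y) ^^ p j"
  let ?S = "\<lambda>j. if j = i then (\<lambda>Y. Y - \<phi> i Y) else id"
  have "defect i (multi_defect k \<phi> p Y) = comp_upto k ?S (comp_upto k ?D Y)"
    by (simp add: comp_upto_single[OF i] multi_defect_def)
  also have "\<dots> = comp_upto k (\<lambda>j. ?S j \<circ> ?D j) Y"
  proof (rule comp_upto_comp)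
    fix j l x assume j: "j \<in> {1..k}" "l \<in> {1..k}" "j \<noteq> l"
    have "defect i (((\<lambda>Y. Y - \<phi> l Y) ^^ p l) x) = ((\<lambda>Y. Y - \<phi> l Y) ^^ p l) (defect i x)"
      by (rule funpow_commute[symmetric]) (rule defect_commute[OF j(2) i])
    then show "?S j (?D l x) = ?D l (?S j x)" by simp
  qed
  also have "comp_upto k (\<lambda>j. ?S j \<circ> ?D j) = multi_defect k \<phi> (p(i := Suc (p i)))"
    unfolding multi_defect_def by (rule comp_upto_cong) auto
  finally show ?thesis by (rule sym)
qed

text \<open>Lowering one exponent of p gives r, and the defect at r minus the defect at p is \<phi>
  i applied to the defect at r, which is positive. Induction on the total degree connects p with
  q.\<close>

lemma multi_defect_antimono:
  assumes pos: "\<And>p. multi_le k p m \<Longrightarrow> positive_op (multi_defect k \<phi> p Q)"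
  shows "multi_le k q p \<Longrightarrow> multi_le k p m \<Longrightarrow>
    positive_op (multi_defect k \<phi> q Q - multi_defect k \<phi> p Q)"
proof (induction "\<Sum>i=1..k. p i" arbitrary: p rule: less_induct)
  case less
  show ?case
  proof (cases "\<forall>i\<in>{1..k}. p i = q i")
    case True
    then have "multi_defect k \<phi> p = multi_defect k \<phi> q" by (intro multi_defect_cong) simp
    then show ?thesis by simp
  next
    case False
    then obtain i where i: "i \<in> {1..k}" "q i < p i"
      using less.prems(1) by (force simp: multi_le_def le_less)
    define r where "r = p(i := p i - 1)"
    have p: "p = r(i := Suc (r i))" using i by (simp add: r_def)
    have r: "multi_le k q r" "multi_le k r m"
      using i less.prems by (force simp: multi_le_def r_def)+
    have "(\<Sum>j=1..k. r j) < (\<Sum>j=1..k. p j)"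
      using i by (intro sum_strict_mono_ex1) (auto simp: r_def intro!: bexI[of _ i])
    then have "positive_op (multi_defect k \<phi> q Q - multi_defect k \<phi> r Q)"
      using r by (rule less.hyps)
    moreover have "positive_op (multi_defect k \<phi> r Q - multi_defect k \<phi> p Q)"
      unfolding p multi_defect_Suc[OF i(1)]
      using dominating_map_positive[OF dom[OF i(1)] pos[OF r(2)]] by simp
    ultimately show ?thesis by (rule positive_op_le_trans)
  qed
qed

lemma multi_defect_lower_bound:
  assumes pos: "\<And>p. multi_le k p m \<Longrightarrow> positive_op (multi_defect k \<phi> p Q)"
    and inv: "invertible_op (multi_defect k \<phi> m Q)"
  obtains g where "0 < g" "\<And>p. multi_le k p m \<Longrightarrow> positive_op (multi_defect k \<phi> p Q - g *\<^sub>R 1)"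
proof -
  have "positive_op (multi_defect k \<phi> m Q)" by (rule pos) (simp add: multi_le_def)
  then obtain g where g: "0 < g" "positive_op (multi_defect k \<phi> m Q - g *\<^sub>R 1)"
    using inv by (rule positive_invertible_lower_bound)
  have "positive_op (multi_defect k \<phi> p Q - g *\<^sub>R 1)" if "multi_le k p m" for p
    using multi_defect_antimono[OF pos that] g(2) by (auto intro: positive_op_le_trans simp: multi_le_def)
  with g(1) show ?thesis using that by blast
qed

lemma multi_defect_invertible:
  assumes pos: "\<And>p. multi_le k p m \<Longrightarrow> positive_op (multi_defect k \<phi> p Q)"
    and inv: "invertible_op (multi_defect k \<phi> m Q)"
  shows "positive_op Q" "invertible_op Q"
proof -
  have Q: "multi_defect k \<phi> (\<lambda>_. 0) Q = Q" by (rule multi_defect_zero) simp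
  have zero: "multi_le k (\<lambda>_. 0) m" by (simp add: multi_le_def)
  show "positive_op Q" using pos[OF zero] by (simp add: Q)
  obtain g where "0 < g" "\<And>p. multi_le k p m \<Longrightarrow> positive_op (multi_defect k \<phi> p Q - g *\<^sub>R 1)"
    using multi_defect_lower_bound[OF pos inv] by blast
  then show "invertible_op Q"
    using positive_lower_bound_invertible[OF \<open>positive_op Q\<close>] zero Q by metis
qed

text \<open>The condition 1 \<le> m i admits the unit multi-index at i, whose defect is Q - \<phi> i
  Q.\<close>

lemma multi_defect_geometric_decay:
  assumes pos: "\<And>p. multi_le k p m \<Longrightarrow> positive_op (multi_defect k \<phi> p Q)"
    and inv: "invertible_op (multi_defect k \<phi> m Q)" and i: "i \<in> {1..k}" "1 \<le> m i"
  shows "geometric_decay (power_norm (\<phi> i))"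
proof -
  note di = dom[OF i(1)]
  obtain g where g: "0 < g" "\<And>p. multi_le k p m \<Longrightarrow> positive_op (multi_defect k \<phi> p Q - g *\<^sub>R 1)"
    using multi_defect_lower_bound[OF pos inv] by blast
  have Q: "multi_defect k \<phi> (\<lambda>_. 0) Q = Q" by (rule multi_defect_zero) simp
  have posQ: "positive_op Q" by (rule multi_defect_invertible[OF pos inv])
  have Qg: "positive_op (Q - g *\<^sub>R 1)" using g(2)[of "\<lambda>_. 0"] by (simp add: Q multi_le_def)
  have "multi_defect k \<phi> ((\<lambda>_. 0)(i := Suc 0)) Q = defect i Q"
    using multi_defect_Suc[OF i(1), of "\<lambda>_. 0"] by (simp add: Q)
  then have Dg: "positive_op (defect i Q - g *\<^sub>R 1)"
    using g(2)[of "(\<lambda>_. 0)(i := Suc 0)"] i by (simp add: multi_le_def)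
  \<comment> \<open>Since Q \<le> b I, g I dominates (g / b) Q, so Q - \<phi> i Q \<ge> g I yields
    the factor r = 1 - g / b. Taking b > g makes r positive.\<close>
  define b where "b = norm Q + 1 + g"
  define r where "r = 1 - g / b"
  have b: "0 < b" "g < b" using g(1) by (simp_all add: b_def add_nonneg_pos add_pos_pos)
  have r: "0 < r" "r < 1" using g(1) b by (simp_all add: r_def)
  have contract: "positive_op (r *\<^sub>R Q - \<phi> i Q)"
  proof (subst positive_op_diff_iff)
    show "positive_op (r *\<^sub>R Q)" using r posQ by (simp add: positive_op_scaleR)
    show "positive_op (\<phi> i Q)" using di posQ by (rule dominating_map_positive)
    show "\<forall>x. quad (\<phi> i Q) x \<le> quad (r *\<^sub>R Q) x"
    proof
      fix x
      have "quad Q x \<le> b * (norm x)\<^sup>2"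
        using quad_le_norm[of Q x] mult_right_mono[of "norm Q" b "(norm x)\<^sup>2"] g(1)
        by (simp add: b_def)
      then have "g / b * quad Q x \<le> g * (norm x)\<^sup>2" using b g(1) by (simp add: field_simps)
      moreover have "g * (norm x)\<^sup>2 \<le> quad Q x - quad (\<phi> i Q) x" using quad_nonneg[OF Dg, of x] by simp
      ultimately show "quad (\<phi> i Q) x \<le> quad (r *\<^sub>R Q) x" by (simp add: r_def left_diff_distrib)
    qed
  qed
  have pow: "positive_op (r ^ s *\<^sub>R Q - (\<phi> i ^^ s) Q)" for s
  proof (induction s)
    case (Suc s)
    have "positive_op (r ^ s *\<^sub>R (r *\<^sub>R Q - \<phi> i Q))" using contract r by (simp add: positive_op_scaleR)
    moreover have "positive_op (\<phi> i (r ^ s *\<^sub>R Q - (\<phi> i ^^ s) Q))" using di Suc by (rule dominating_map_positive)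
    \<comment> \<open>This sum telescopes: the mixed terms r^s \<phi>(Q) cancel.\<close>
    ultimately have "positive_op (r ^ s *\<^sub>R (r *\<^sub>R Q - \<phi> i Q) + \<phi> i (r ^ s *\<^sub>R Q - (\<phi> i ^^ s) Q))"
      by (rule positive_op_add)
    then show ?case
      by (simp add: dominating_map_diff[OF di] dominating_map_scaleR[OF di] scaleR_diff_right mult.commute)
  qed simp
  \<comment> \<open>The chain g \<phi>^s(I) \<le> \<phi>^s(Q) \<le> r^s Q \<le> r^s norm(Q)
    I.\<close>
  have le: "power_norm (\<phi> i) s \<le> norm Q / g * r ^ s" for s
    unfolding power_norm_def
  proof (rule positive_op_norm_le)
    have ds: "dominating_map (\<phi> i ^^ s)" by (rule dominating_map_funpow[OF di])
    show "positive_op ((\<phi> i ^^ s) 1)" by (rule dominating_map_positive[OF ds positive_op_one])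
    show "0 \<le> norm Q / g * r ^ s" using g(1) r by simp
    fix x
    have "positive_op ((\<phi> i ^^ s) (Q - g *\<^sub>R 1))" by (rule dominating_map_positive[OF ds Qg])
    then have "g * quad ((\<phi> i ^^ s) 1) x \<le> quad ((\<phi> i ^^ s) Q) x"
      using quad_nonneg by (fastforce simp: dominating_map_diff[OF ds] dominating_map_scaleR[OF ds])
    also have "\<dots> \<le> r ^ s * quad Q x" using quad_nonneg[OF pow, of s x] by simp
    also have "\<dots> \<le> r ^ s * (norm Q * (norm x)\<^sup>2)"
      using r by (intro mult_left_mono quad_le_norm) simp
    finally show "quad ((\<phi> i ^^ s) 1) x \<le> norm Q / g * r ^ s * (norm x)\<^sup>2"
      using g(1) by (simp add: field_simps)
  qed
  have "(\<lambda>s. norm Q / g * r ^ s) \<longlonglongrightarrow> norm Q / g * 0"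
    using r by (intro tendsto_mult tendsto_const LIMSEQ_power_zero) simp
  then have lim: "(\<lambda>s. norm Q / g * r ^ s) \<longlonglongrightarrow> 0" by simp
  have "power_norm (\<phi> i) \<longlonglongrightarrow> 0"
    by (rule tendsto_sandwich[OF _ _ tendsto_const lim]) (intro always_eventually allI le power_norm_nonneg)+
  then show ?thesis
    using geometric_decay_iff_tendsto_0[of "power_norm (\<phi> i)"] power_norm_submult[OF di] by simp
qed

end

section \<open>Multi-index series\<close>

lemma bij_betw_PiE_Suc:
  "bij_betw (\<lambda>(s, t). s(Suc l := t)) (({1..l} \<rightarrow>\<^sub>E UNIV) \<times> UNIV) ({1..Suc l} \<rightarrow>\<^sub>E UNIV)"
  by (rule bij_betwI[where g = "\<lambda>s. (s(Suc l := undefined), s (Suc l))"])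
    (auto simp: PiE_iff extensional_def fun_eq_iff)

text \<open>Multi-indices are extensional functions, so each is counted once. The sum of a product
  of nonnegative one-variable terms factorizes, one coordinate at a time.\<close>

lemma summable_on_prod_PiE:
  fixes h :: "nat \<Rightarrow> 'b \<Rightarrow> real"
  assumes "\<And>i. i \<in> {1..l} \<Longrightarrow> h i summable_on UNIV" "\<And>i x. i \<in> {1..l} \<Longrightarrow> 0 \<le> h i x"
  shows "(\<lambda>s. \<Prod>i=1..l. h i (s i)) summable_on ({1..l} \<rightarrow>\<^sub>E UNIV)"
  using assms
proof (induction l)
  case (Suc l)
  define H where "H s = (\<Prod>i=1..l. h i (s i))" for s
  have H: "H summable_on ({1..l} \<rightarrow>\<^sub>E UNIV)" unfolding H_def[abs_def] using Suc by simp
  obtain c where c: "(h (Suc l) has_sum c) UNIV" using Suc.prems(1)[of "Suc l"] by (auto simp: summable_on_def)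
  have "(\<lambda>p. \<Prod>i=1..Suc l. h i ((case p of (s, t) \<Rightarrow> s(Suc l := t)) i)) summable_on (({1..l} \<rightarrow>\<^sub>E UNIV) \<times> UNIV)"
  proof (rule summable_on_SigmaI)
    show "((\<lambda>t. \<Prod>i=1..Suc l. h i ((case (s, t) of (s, t) \<Rightarrow> s(Suc l := t)) i)) has_sum (H s * c)) UNIV" for s
      using has_sum_cmult_right[OF c, of "H s"] by (simp add: H_def)
    show "(\<lambda>s. H s * c) summable_on ({1..l} \<rightarrow>\<^sub>E UNIV)" by (rule summable_on_cmult_left[OF H])
    show "0 \<le> (\<Prod>i=1..Suc l. h i ((case (s, t) of (s, t) \<Rightarrow> s(Suc l := t)) i))" for s t
      by (intro prod_nonneg Suc.prems) simp
  qed
  then show ?case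
    unfolding summable_on_reindex_bij_betw[OF bij_betw_PiE_Suc, of "\<lambda>s. \<Prod>i=1..Suc l. h i (s i)"] .
qed simp

locale decaying_maps = commuting_maps k \<phi>
  for k and \<phi> :: "nat \<Rightarrow> 'h::complex_hilbert bop \<Rightarrow> 'h bop" +
  assumes decay: "i \<in> {1..k} \<Longrightarrow> geometric_decay (power_norm (\<phi> i))"
begin

text \<open>A composite of one-variable inverses, which makes the algebra immediate; its expansion
  into the multi-index series is \<open>solution_has_sum\<close>.\<close>

definition solution :: "(nat \<Rightarrow> nat) \<Rightarrow> 'h bop \<Rightarrow> 'h bop" where
  "solution m = comp_upto k (\<lambda>i. binomial_resolvent (\<phi> i) (m i))"

text \<open>Each power of id - \<phi> i passes the resolvents of the other indices and cancels p i
  factors of its own. The result is again a composite of resolvents, hence positive on positive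
  operators.\<close>

lemma multi_defect_solution:
  assumes "multi_le k p m"
  shows "multi_defect k \<phi> p (solution m R) = solution (\<lambda>i. m i - p i) R"
proof -
  have "multi_defect k \<phi> p (solution m R) =
      comp_upto k (\<lambda>i. ((\<lambda>Y. Y - \<phi> i Y) ^^ p i) \<circ> binomial_resolvent (\<phi> i) (m i)) R"
    unfolding multi_defect_def solution_def
  proof (rule comp_upto_comp)
    fix i j x assume ij: "i \<in> {1..k}" "j \<in> {1..k}" "i \<noteq> j"
    note N = binomial_resolvent_commute[OF dom[OF ij(2)] decay[OF ij(2)] dom[OF ij(1)] comm[OF ij(2,1)]]
    show "((\<lambda>Y. Y - \<phi> i Y) ^^ p i) (binomial_resolvent (\<phi> j) (m j) x) =
        binomial_resolvent (\<phi> j) (m j) (((\<lambda>Y. Y - \<phi> i Y) ^^ p i) x)"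
      by (rule funpow_commute)
        (simp only: N binomial_resolvent_diff[OF dom[OF ij(2)] decay[OF ij(2)]])
  qed
  also have "comp_upto k (\<lambda>i. ((\<lambda>Y. Y - \<phi> i Y) ^^ p i) \<circ> binomial_resolvent (\<phi> i) (m i))
      = solution (\<lambda>i. m i - p i)"
    unfolding solution_def
  proof (intro comp_upto_cong ext)
    fix i Y assume i: "i \<in> {1..k}"
    then have "p i \<le> m i" using assms by (simp add: multi_le_def)
    with funpow_defect_binomial_resolvent[OF dom[OF i] decay[OF i]]
    show "(((\<lambda>Y. Y - \<phi> i Y) ^^ p i) \<circ> binomial_resolvent (\<phi> i) (m i)) Y
        = binomial_resolvent (\<phi> i) (m i - p i) Y" by simp
  qed
  finally show ?thesis .
qed

lemma multi_defect_solution_self: "multi_defect k \<phi> m (solution m R) = R"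
proof -
  have "multi_defect k \<phi> m (solution m R) = solution (\<lambda>_. 0) R"
    using multi_defect_solution[of m m R] by (simp add: multi_le_def)
  also have "\<dots> = R"
    unfolding solution_def
    by (rule comp_upto_invariant[where P = "\<lambda>X. X = R"]) (simp_all add: binomial_resolvent_def)
  finally show ?thesis .
qed

lemma multi_defect_solution_positive:
  assumes "positive_op R" "multi_le k p m"
  shows "positive_op (multi_defect k \<phi> p (solution m R))"
  unfolding multi_defect_solution[OF assms(2)]
  unfolding solution_def
proof (rule comp_upto_invariant[where P = positive_op])
  show "positive_op (binomial_resolvent (\<phi> i) (m i - p i) Y)" if "i \<in> {1..k}" "positive_op Y" for i Y
    by (rule binomial_resolvent_positive[OF dom[OF that(1)] decay[OF that(1)] that(2)])
qed (rule assms(1))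

lemma multi_defect_unique:
  assumes "multi_defect k \<phi> m X = multi_defect k \<phi> m Y" shows "X = Y"
proof -
  have "inj (multi_defect k \<phi> m)"
    unfolding multi_defect_def
    by (rule comp_upto_inj, rule inj_fn, rule defect_inj) (rule dom decay; assumption)+
  then show ?thesis using assms by (rule injD)
qed

lemma comp_upto_powers_dominating:
  "l \<le> k \<Longrightarrow> dominating_map (comp_upto l (\<lambda>i. \<phi> i ^^ s i))"
proof (induction l)
  case (Suc l)
  then have "dominating_map (\<phi> (Suc l) ^^ s (Suc l))" by (intro dominating_map_funpow dom) simp
  with Suc show ?case by (simp add: dominating_map_def)
qed (simp add: dominating_map_def)

lemma norm_comp_upto_powers_le:
  "l \<le> k \<Longrightarrow> norm (comp_upto l (\<lambda>i. \<phi> i ^^ s i) R) \<le> (\<Prod>i=1..l. power_norm (\<phi> i) (s i)) * norm R"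
proof (induction l arbitrary: R)
  case (Suc l)
  have "norm (comp_upto (Suc l) (\<lambda>i. \<phi> i ^^ s i) R) \<le>
      (\<Prod>i=1..l. power_norm (\<phi> i) (s i)) * norm ((\<phi> (Suc l) ^^ s (Suc l)) R)"
    using Suc by simp
  also have "\<dots> \<le> (\<Prod>i=1..l. power_norm (\<phi> i) (s i)) * (power_norm (\<phi> (Suc l)) (s (Suc l)) * norm R)"
    using Suc.prems by (intro mult_left_mono norm_funpow_le dom prod_nonneg) simp_all
  finally show ?case by (simp add: mult.assoc)
qed simp

text \<open>Induction on the number of variables. The last map acts first, so summing over the last
  index replaces R by its resolvent; this is why R is generalized.\<close>

lemma solution_has_sum:
  assumes m: "\<And>i. i \<in> {1..k} \<Longrightarrow> 1 \<le> m i"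
  shows "((\<lambda>s. real (\<Prod>i=1..k. (s i + m i - 1) choose (m i - 1)) *\<^sub>R comp_upto k (\<lambda>i. \<phi> i ^^ s i) R)
    has_sum solution m R) ({1..k} \<rightarrow>\<^sub>E UNIV)"
proof -
  define b where "b i t = real ((t + m i - 1) choose (m i - 1))" for i t
  \<comment> \<open>The scalar majorant in one coordinate; products of these bound the operator
    terms in norm.\<close>
  define h where "h i t = b i t * power_norm (\<phi> i) t" for i t
  define f where "f l R s = (\<Prod>i=1..l. b i (s i)) *\<^sub>R comp_upto l (\<lambda>i. \<phi> i ^^ s i) R" for l R s
  have h: "h i summable_on UNIV" if "i \<in> {1..k}" for i
  proof -
    have "summable (h i)"
      unfolding h_def[abs_def] b_def using geometric_decay_summable[OF decay[OF that], of "m i - 1"] m[OF that]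
      by simp
    then show ?thesis
      by (intro summable_nonneg_imp_summable_on) (simp_all add: h_def b_def)
  qed
  have norm_f: "norm (f l R s) \<le> (\<Prod>i=1..l. h i (s i)) * norm R" if "l \<le> k" for l R s
  proof -
    have b0: "0 \<le> (\<Prod>i=1..l. b i (s i))" by (intro prod_nonneg) (simp add: b_def)
    then have "norm (f l R s) = (\<Prod>i=1..l. b i (s i)) * norm (comp_upto l (\<lambda>i. \<phi> i ^^ s i) R)"
      by (simp add: f_def)
    also have "\<dots> \<le> (\<Prod>i=1..l. b i (s i)) * ((\<Prod>i=1..l. power_norm (\<phi> i) (s i)) * norm R)"
      using b0 norm_comp_upto_powers_le[OF that] by (intro mult_left_mono)
    finally show ?thesis by (simp add: h_def prod.distrib mult.assoc)
  qed
  have "l \<le> k \<Longrightarrow> (f l R has_sum comp_upto l (\<lambda>i. binomial_resolvent (\<phi> i) (m i)) R) ({1..l} \<rightarrow>\<^sub>E UNIV)" for l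
  proof (induction l arbitrary: R)
    case 0
    have "f 0 R = (\<lambda>_. R)" by (simp add: f_def fun_eq_iff)
    then show ?case using has_sum_finite[of "{\<lambda>_. undefined}" "\<lambda>_. R"] by simp
  next
    case (Suc l)
    let ?i = "Suc l"
    have i: "?i \<in> {1..k}" using Suc.prems by simp
    define N where "N = binomial_resolvent (\<phi> ?i) (m ?i) R"
    have split: "f ?i R (s(?i := t)) =
        (\<Prod>i=1..l. b i (s i)) *\<^sub>R comp_upto l (\<lambda>i. \<phi> i ^^ s i) (b ?i t *\<^sub>R (\<phi> ?i ^^ t) R)" for s t
    proof -
      have "comp_upto l (\<lambda>i. \<phi> i ^^ (s(?i := t)) i) = comp_upto l (\<lambda>i. \<phi> i ^^ s i)"
        by (rule comp_upto_cong) simp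
      then show ?thesis
        using Suc.prems
        by (simp add: f_def dominating_map_scaleR[OF comp_upto_powers_dominating] mult.commute)
    qed
    have inner: "((\<lambda>t. f ?i R (case (s, t) of (s, t) \<Rightarrow> s(?i := t))) has_sum f l N s) UNIV" for s
    proof -
      have "dominating_map (comp_upto l (\<lambda>i. \<phi> i ^^ s i))"
        using Suc.prems by (intro comp_upto_powers_dominating) simp
      then have "bounded_linear (\<lambda>Z. (\<Prod>i=1..l. b i (s i)) *\<^sub>R comp_upto l (\<lambda>i. \<phi> i ^^ s i) Z)"
        by (intro bounded_linear_compose[OF bounded_linear_scaleR_right] dominating_map_bounded_linear)
      moreover have "((\<lambda>t. b ?i t *\<^sub>R (\<phi> ?i ^^ t) R) has_sum N) UNIV"
        unfolding b_def N_def by (rule binomial_resolvent_has_sum[OF dom[OF i] decay[OF i] m[OF i]])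
      ultimately have "((\<lambda>t. (\<Prod>i=1..l. b i (s i)) *\<^sub>R comp_upto l (\<lambda>i. \<phi> i ^^ s i) (b ?i t *\<^sub>R (\<phi> ?i ^^ t) R))
          has_sum ((\<Prod>i=1..l. b i (s i)) *\<^sub>R comp_upto l (\<lambda>i. \<phi> i ^^ s i) N)) UNIV"
        by (rule has_sum_bounded_linear)
      then show ?thesis unfolding prod.case split by (simp add: f_def)
    qed
    have outer: "(f l N has_sum comp_upto ?i (\<lambda>i. binomial_resolvent (\<phi> i) (m i)) R) ({1..l} \<rightarrow>\<^sub>E UNIV)"
      using Suc.IH[of N] Suc.prems by (simp add: N_def)
    \<comment> \<open>The iterated sum equals the sum over the product set only once joint
      summability is known.\<close>
    have "(\<lambda>s. \<Prod>i=1..?i. h i (s i)) summable_on ({1..?i} \<rightarrow>\<^sub>E UNIV)"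
      using Suc.prems by (intro summable_on_prod_PiE h) (auto simp: h_def b_def)
    then have "(\<lambda>s. (\<Prod>i=1..?i. h i (s i)) * norm R) summable_on ({1..?i} \<rightarrow>\<^sub>E UNIV)"
      by (rule summable_on_cmult_left)
    then have "(\<lambda>s. norm (f ?i R s)) summable_on ({1..?i} \<rightarrow>\<^sub>E UNIV)"
      by (rule Infinite_Sum.abs_summable_on_comparison_test') (rule norm_f[OF Suc.prems])
    then have "f ?i R summable_on ({1..?i} \<rightarrow>\<^sub>E UNIV)" by (rule Infinite_Sum.abs_summable_summable)
    then have "(\<lambda>p. f ?i R (case p of (s, t) \<Rightarrow> s(?i := t))) summable_on (({1..l} \<rightarrow>\<^sub>E UNIV) \<times> UNIV)"
      by (subst summable_on_reindex_bij_betw[OF bij_betw_PiE_Suc])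
    with inner outer have "((\<lambda>p. f ?i R (case p of (s, t) \<Rightarrow> s(?i := t))) has_sum
        comp_upto ?i (\<lambda>i. binomial_resolvent (\<phi> i) (m i)) R) (({1..l} \<rightarrow>\<^sub>E UNIV) \<times> UNIV)"
      by (rule has_sum_SigmaI)
    then show ?case by (subst (asm) has_sum_reindex_bij_betw[OF bij_betw_PiE_Suc])
  qed
  from this[of k] show ?thesis by (simp add: f_def[abs_def] b_def solution_def)
qed

end

section \<open>Similarity\<close>

lemma Delta_eq_multi_defect: "Delta k n a X = multi_defect k (\<lambda>i. Phi (n i) (a i) (X i))"
  by (simp add: fun_eq_iff Delta_def multi_defect_def)

text \<open>Y \<mapsto> C Y C^* intertwines the maps of the two similar tuples, hence also their
  defects and all composites of these.\<close>

lemma Delta_similar: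
  assumes inv: "C * D = 1" "D * C = 1"
    and X': "\<And>i j. i \<in> {1..k} \<Longrightarrow> j \<in> {1..n i} \<Longrightarrow> X' i j = C * X i j * D"
    and adm: "\<And>i. i \<in> {1..k} \<Longrightarrow> admissible (n i) (a i) (X i)"
  shows "Delta k n a X' p (C * Y * adj C) = C * Delta k n a X p Y * adj C"
  unfolding Delta_def
proof (rule comp_upto_intertwine[symmetric])
  fix i Y assume i: "i \<in> {1..k}"
  have D: "D * (C * Y * adj C) * adj D = Y" for Y
  proof -
    have "D * (C * Y * adj C) * adj D = (D * C) * Y * adj (D * C)"
      by (simp add: adj_times mult.assoc)
    then show ?thesis by (simp add: inv)
  qed
  have "Phi (n i) (a i) (X' i) (C * Y * adj C) = C * Phi (n i) (a i) (X i) Y * adj C" for Y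
    using Phi_similar[where X' = "X' i" and X = "X i", OF inv X'[OF i] adm[OF i], of "C * Y * adj C"]
    by (simp add: D)
  then have "((\<lambda>Y. Y - Phi (n i) (a i) (X' i) Y) ^^ s) (C * Y * adj C) =
      C * ((\<lambda>Y. Y - Phi (n i) (a i) (X i) Y) ^^ s) Y * adj C" for s
    by (induction s) (simp_all add: left_diff_distrib right_diff_distrib)
  then show "C * ((\<lambda>Y. Y - Phi (n i) (a i) (X i) Y) ^^ p i) Y * adj C =
      ((\<lambda>Y. Y - Phi (n i) (a i) (X' i) Y) ^^ p i) (C * Y * adj C)" by (rule sym)
qed

lemma invertible_op_adj:
  assumes "invertible_op C" shows "invertible_op (adj C)"
proof -
  obtain D where "D * C = 1" "C * D = 1" using assms by (rule invertible_opE)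
  then show ?thesis by (intro invertible_opI[of "adj D"]) (simp_all add: adj_times[symmetric])
qed

lemma strictly_positive_op_conj:
  "strictly_positive_op T \<Longrightarrow> invertible_op C \<Longrightarrow> strictly_positive_op (C * T * adj C)"
  unfolding strictly_positive_op_def
  by (intro conjI positive_op_conj invertible_op_times invertible_op_adj) simp_all

lemma prod_list_similar:
  fixes C D :: "'a::monoid_mult"
  assumes "C * D = 1" "D * C = 1"
  shows "prod_list (map (\<lambda>i. C * B i * D) xs) = C * prod_list (map B xs) * D"
proof (induction xs)
  case (Cons x xs)
  have "prod_list (map (\<lambda>i. C * B i * D) (x # xs)) = C * B x * (D * C) * prod_list (map B xs) * D"
    unfolding list.map prod_list.Cons Cons.IH by (simp only: mult.assoc)
  then show ?case by (simp add: assms mult.assoc)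
qed (simp add: assms)

lemma eval_poly_similar:
  assumes inv: "C * D = 1" "D * C = 1"
  shows "eval_poly k q (\<lambda>i j. C * X i j * D) = C * eval_poly k q X * D"
proof -
  have word: "word_op (\<lambda>j. C * X i j * D) w = C * word_op (X i) w * D" for i w
    by (rule word_op_similar[OF inv, of UNIV]) auto
  have scale: "c *\<^sub>C (C * T * D) = C * (c *\<^sub>C T) * D" for c T
    by (rule bop_eqI) (simp add: app_scaleC)
  show ?thesis
    unfolding eval_poly_def word prod_list_similar[OF inv] scale
    by (simp add: sum_distrib_left sum_distrib_right)
qed

lemma similar_to_variety_iff:
  fixes A :: "nat \<Rightarrow> nat \<Rightarrow> 'h::complex_hilbert bop"
  assumes maps: "commuting_maps k (\<lambda>i. Phi (n i) (a i) (A i))"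
    and comm: "commuting_tuple k n A"
    and adm: "\<And>i. i \<in> {1..k} \<Longrightarrow> admissible (n i) (a i) (A i)"
    and zero: "\<forall>q\<in>Qs. eval_poly k q A = 0"
  shows "(\<exists>T \<in> nc_variety k n a m Qs. strictly_positive_op (Delta k n a T m 1) \<and>
            (\<exists>Y Yinv :: 'h bop. Yinv * Y = 1 \<and> Y * Yinv = 1 \<and>
              (\<forall>i\<in>{1..k}. \<forall>j\<in>{1..n i}. A i j = Yinv * T i j * Y))) \<longleftrightarrow>
         (\<exists>Q. positive_op Q \<and> (\<forall>p. multi_le k p m \<longrightarrow> positive_op (Delta k n a A p Q)) \<and>
            strictly_positive_op (Delta k n a A m Q))" (is "?L \<longleftrightarrow> ?R")
proof
  assume ?L
  then obtain T Y Yinv where T: "T \<in> nc_variety k n a m Qs"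
    and pos: "strictly_positive_op (Delta k n a T m 1)"
    and Y: "Yinv * Y = 1" "Y * Yinv = 1"
    and A: "\<forall>i\<in>{1..k}. \<forall>j\<in>{1..n i}. A i j = Yinv * T i j * Y" by blast
  have adm_T: "admissible (n i) (a i) (T i)" if "i \<in> {1..k}" for i
    using T adm[OF that] that by (simp add: nc_variety_def polydomain_def admissible_def)
  \<comment> \<open>The witness is Q = Y^(-1) (Y^(-1))^*, the image of the identity; the factor 1 is
    kept to match the shape of \<open>Delta_similar\<close>.\<close>
  have Delta: "Delta k n a A p (Yinv * 1 * adj Yinv) = Yinv * Delta k n a T p 1 * adj Yinv" for p
    using A by (intro Delta_similar[OF Y _ adm_T]) simp_all
  show ?R
  proof (intro exI conjI allI impI)
    show "positive_op (Yinv * 1 * adj Yinv)" by (intro positive_op_conj positive_op_one)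
    show "positive_op (Delta k n a A p (Yinv * 1 * adj Yinv))" if "multi_le k p m" for p
      unfolding Delta using T that by (intro positive_op_conj) (simp add: nc_variety_def polydomain_def)
    show "strictly_positive_op (Delta k n a A m (Yinv * 1 * adj Yinv))"
      unfolding Delta by (intro strictly_positive_op_conj pos invertible_opI[OF Y(2,1)])
  qed
next
  assume ?R
  then obtain Q where Q: "\<And>p. multi_le k p m \<Longrightarrow> positive_op (Delta k n a A p Q)"
    "strictly_positive_op (Delta k n a A m Q)" by blast
  have "positive_op Q" "invertible_op Q"
    using commuting_maps.multi_defect_invertible[OF maps, of m Q] Q
    by (simp_all add: Delta_eq_multi_defect strictly_positive_op_def)
  then obtain Z where Z: "adj Z = Z" "Z * Z = Q" "invertible_op Z"
    by (rule positive_invertible_sqrt)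
  then obtain W where W: "W * Z = 1" "Z * W = 1" using invertible_opE by blast
  define T where "T = (\<lambda>i j. W * A i j * Z)"
  \<comment> \<open>Here self-adjointness of the root matters: Q = Z Z^*, so conjugation by the
    inverse of Z carries Q to the identity.\<close>
  have "W * Q * adj W = (W * Z) * adj (W * Z)"
    by (simp add: adj_times Z(1) Z(2)[symmetric] mult.assoc)
  then have WQW: "W * Q * adj W = 1" by (simp add: W)
  have Delta: "Delta k n a T p 1 = W * Delta k n a A p Q * adj W" for p
  proof -
    have "Delta k n a T p (W * Q * adj W) = W * Delta k n a A p Q * adj W"
      by (rule Delta_similar[OF W]) (rule adm, assumption | simp add: T_def)+
    then show ?thesis by (simp add: WQW)
  qed
  have "T \<in> polydomain k n a m"
    unfolding polydomain_def
  proof (intro CollectI conjI ballI allI impI)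
    have "T s j * T t l = W * (A s j * A t l) * Z" for s j t l
    proof -
      have "T s j * T t l = W * A s j * (Z * W) * A t l * Z" by (simp add: T_def mult.assoc)
      then show ?thesis by (simp add: W mult.assoc)
    qed
    then show "commuting_tuple k n T" using comm by (simp add: commuting_tuple_def)
    show "Phi_well_defined (n i) (a i) (T i)" if "i \<in> {1..k}" for i
      using similar_admissible[where X' = "T i" and X = "A i", OF W _ adm[OF that]]
      by (simp add: T_def admissible_def)
    show "positive_op (Delta k n a T p 1)" if "multi_le k p m" for p
      unfolding Delta by (intro positive_op_conj Q(1) that)
  qed
  moreover have "eval_poly k q T = 0" if "q \<in> Qs" for q
    unfolding T_def eval_poly_similar[OF W] using zero that by simp
  ultimately have "T \<in> nc_variety k n a m Qs" by (simp add: nc_variety_def)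
  moreover have "strictly_positive_op (Delta k n a T m 1)"
    unfolding Delta by (intro strictly_positive_op_conj Q(2) invertible_opI[OF W(2,1)])
  moreover have "A i j = Z * T i j * W" for i j
  proof -
    have "Z * T i j * W = (Z * W) * A i j * (Z * W)" by (simp add: T_def mult.assoc)
    then show ?thesis by (simp add: W)
  qed
  ultimately show ?L using W by blast
qed

section \<open>Assembling the equivalences\<close>

lemma power_bounded_pure_if_decay:
  assumes dom: "dominating_map \<phi>" and decay: "geometric_decay (power_norm \<phi>)"
  shows "power_bounded \<phi>" "pure \<phi>"
proof -
  have lim: "power_norm \<phi> \<longlonglongrightarrow> 0"
    using geometric_decay_iff_tendsto_0[of "power_norm \<phi>"] decay power_norm_submult[OF dom] by simp
  then have "Bseq (power_norm \<phi>)" by (simp add: convergent_imp_Bseq convergentI)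
  then obtain K where K: "\<And>s. power_norm \<phi> s \<le> K" by (auto simp: Bseq_def)
  have onorm: "onorm (\<phi> ^^ s) \<le> K" for s
  proof (rule onorm_bound)
    show "0 \<le> K" using K[of 0] power_norm_nonneg order_trans by blast
    show "norm ((\<phi> ^^ s) Z) \<le> K * norm Z" for Z
      using norm_funpow_le[OF dom, of s Z] mult_right_mono[OF K[of s], of "norm Z"] by simp
  qed
  show "power_bounded \<phi>"
    unfolding power_bounded_def
  proof (intro conjI allI)
    show "bounded_linear (\<phi> ^^ s)" for s
      by (rule dominating_map_bounded_linear[OF dominating_map_funpow[OF dom]])
    show "bdd_above (range (\<lambda>s. onorm (\<phi> ^^ s)))" by (rule bdd_aboveI2) (rule onorm)
  qed
  have "(\<lambda>s. (\<phi> ^^ s) 1) \<longlonglongrightarrow> 0"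
    using lim unfolding power_norm_def[abs_def] by (rule tendsto_norm_zero_cancel)
  from bounded_linear.tendsto[OF bounded_linear_cinner_left bounded_linear.tendsto[OF bounded_linear_app_left this]]
  show "pure \<phi>" by (simp add: pure_def)
qed

theorem theorem3p8:
  fixes k :: nat and n m :: "nat \<Rightarrow> nat"
    and a :: "nat \<Rightarrow> nat list \<Rightarrow> real"
    and Qs :: "nc_poly set"
    and A :: "nat \<Rightarrow> nat \<Rightarrow> 'h::complex_hilbert bop"
  assumes "separable_space (euclidean :: 'h topology)"
    and "1 \<le> k"
    and "\<forall>i\<in>{1..k}. 1 \<le> n i"
    and "\<forall>i\<in>{1..k}. 1 \<le> m i"
    and "\<forall>i\<in>{1..k}. positive_regular (n i) (a i)"
    and "Qs \<subseteq> nc_polys k n"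
    and "commuting_tuple k n A"
    and "\<forall>i\<in>{1..k}. Phi_well_defined (n i) (a i) (A i)"
    and "\<forall>q\<in>Qs. eval_poly k q A = 0"
  shows
    "let \<Phi> = (\<lambda>i. Phi (n i) (a i) (A i));
         \<Delta> = Delta k n a A;
         stmt1 = (\<exists>T \<in> nc_variety k n a m Qs. strictly_positive_op (Delta k n a T m 1) \<and>
                   (\<exists>Y Yinv :: 'h bop. Yinv * Y = 1 \<and> Y * Yinv = 1 \<and>
                     (\<forall>i\<in>{1..k}. \<forall>j\<in>{1..n i}. A i j = Yinv * T i j * Y)));
         stmt2 = (\<exists>Q. positive_op Q \<and> (\<forall>p. multi_le k p m \<longrightarrow> positive_op (\<Delta> p Q)) \<and>
                   strictly_positive_op (\<Delta> m Q));
         stmt3 = (\<forall>i\<in>{1..k}. joint_spectral_radius (n i) (a i) (A i) < 1);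
         stmt4 = (\<forall>i\<in>{1..k}. (\<lambda>s. norm ((\<Phi> i ^^ s) 1)) \<longlonglongrightarrow> 0);
         stmt5 = ((\<forall>i\<in>{1..k}. power_bounded (\<Phi> i) \<and> pure (\<Phi> i)) \<and>
                  (\<exists>R. positive_op R \<and> invertible_op R \<and>
                    (\<exists>X. positive_op X \<and> \<Delta> m X = R \<and>
                      (\<forall>p. multi_le k p m \<longrightarrow> positive_op (\<Delta> p X)))))
     in (stmt1 \<longleftrightarrow> stmt2) \<and> (stmt2 \<longleftrightarrow> stmt3) \<and> (stmt3 \<longleftrightarrow> stmt4) \<and> (stmt4 \<longleftrightarrow> stmt5) \<and>
        (stmt1 \<longrightarrow>
          (\<forall>R. positive_op R \<and> invertible_op R \<longrightarrow>
            (\<exists>X. ((\<lambda>s. real (\<Prod>i=1..k. (s i + m i - 1) choose (m i - 1)) *\<^sub>R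
                        comp_upto k (\<lambda>i. \<Phi> i ^^ s i) R) has_sum X) ({1..k} \<rightarrow>\<^sub>E UNIV) \<and>
                 positive_op X \<and> \<Delta> m X = R \<and>
                 (\<forall>X'. positive_op X' \<and> \<Delta> m X' = R \<longrightarrow> X' = X) \<and>
                 invertible_op X)))"
proof -
  define \<Phi> where "\<Phi> = (\<lambda>i. Phi (n i) (a i) (A i))"
  note n_m = assms(4)
  have adm: "admissible (n i) (a i) (A i)" if "i \<in> {1..k}" for i
    using assms(5,8) that by (simp add: admissible_def positive_regular_def)
  interpret commuting_maps k \<Phi>
  proof
    show "dominating_map (\<Phi> i)" if "i \<in> {1..k}" for i
      unfolding \<Phi>_def by (rule dominating_map_Phi[OF adm[OF that]])
    show "\<Phi> i (\<Phi> j Y) = \<Phi> j (\<Phi> i Y)" if "i \<in> {1..k}" "j \<in> {1..k}" for i j Y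
    proof (cases "i = j")
      case False
      then show ?thesis
        unfolding \<Phi>_def using assms(7) that
        by (intro Phi_commute adm) (auto simp: commuting_tuple_def)
    qed simp
  qed
  have Delta: "Delta k n a A = multi_defect k \<Phi>"
    by (simp add: Delta_eq_multi_defect \<Phi>_def)
  define stmt1 where "stmt1 \<longleftrightarrow> (\<exists>T \<in> nc_variety k n a m Qs. strictly_positive_op (Delta k n a T m 1) \<and>
                   (\<exists>Y Yinv :: 'h bop. Yinv * Y = 1 \<and> Y * Yinv = 1 \<and>
                     (\<forall>i\<in>{1..k}. \<forall>j\<in>{1..n i}. A i j = Yinv * T i j * Y)))"
  define stmt2 where "stmt2 \<longleftrightarrow> (\<exists>Q. positive_op Q \<and> (\<forall>p. multi_le k p m \<longrightarrow> positive_op (multi_defect k \<Phi> p Q)) \<and>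
                   strictly_positive_op (multi_defect k \<Phi> m Q))"
  define stmt3 where "stmt3 \<longleftrightarrow> (\<forall>i\<in>{1..k}. joint_spectral_radius (n i) (a i) (A i) < 1)"
  define stmt4 where "stmt4 \<longleftrightarrow> (\<forall>i\<in>{1..k}. (\<lambda>s. norm ((\<Phi> i ^^ s) 1)) \<longlonglongrightarrow> 0)"
  define stmt5 where "stmt5 \<longleftrightarrow> ((\<forall>i\<in>{1..k}. power_bounded (\<Phi> i) \<and> pure (\<Phi> i)) \<and>
                  (\<exists>R. positive_op R \<and> invertible_op R \<and>
                    (\<exists>X. positive_op X \<and> multi_defect k \<Phi> m X = R \<and>
                      (\<forall>p. multi_le k p m \<longrightarrow> positive_op (multi_defect k \<Phi> p X)))))"
  \<comment> \<open>The hub: (iii) and (iv) are each equivalent to it, (ii) implies it, and it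
    implies (v), which returns to (ii).\<close>
  define decay where "decay \<longleftrightarrow> (\<forall>i\<in>{1..k}. geometric_decay (power_norm (\<Phi> i)))"
  have eq12: "stmt1 \<longleftrightarrow> stmt2"
    unfolding stmt1_def stmt2_def Delta[symmetric]
    by (rule similar_to_variety_iff) (use commuting_maps_axioms assms(7,9) adm in \<open>auto simp: \<Phi>_def\<close>)
  have "geometric_decay (power_norm (\<Phi> i)) \<longleftrightarrow> joint_spectral_radius (n i) (a i) (A i) < 1"
    if "i \<in> {1..k}" for i
    using geometric_decay_iff_root_limit[of "power_norm (\<Phi> i)"] power_norm_submult[OF dom[OF that]]
    by (simp add: joint_spectral_radius_def power_norm_def \<Phi>_def)
  then have eq3: "stmt3 \<longleftrightarrow> decay" unfolding stmt3_def decay_def by blast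
  have "geometric_decay (power_norm (\<Phi> i)) \<longleftrightarrow> (\<lambda>s. norm ((\<Phi> i ^^ s) 1)) \<longlonglongrightarrow> 0"
    if "i \<in> {1..k}" for i
    using geometric_decay_iff_tendsto_0[of "power_norm (\<Phi> i)"] power_norm_submult[OF dom[OF that]]
    by (simp add: power_norm_def[abs_def])
  then have eq4: "stmt4 \<longleftrightarrow> decay" unfolding stmt4_def decay_def by blast
  have decay_if_2: "decay" if "stmt2"
    using that multi_defect_geometric_decay[of m] n_m
    unfolding stmt2_def decay_def strictly_positive_op_def by blast
  have decaying: "decaying_maps k \<Phi>" if "decay"
    using that by unfold_locales (simp add: decay_def)
  \<comment> \<open>The last conjunct goes beyond the final claim; it supplies the positivity of all
    lower defects required in (v).\<close>
  have solution: "\<exists>X. ((\<lambda>s. real (\<Prod>i=1..k. (s i + m i - 1) choose (m i - 1)) *\<^sub>R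
        comp_upto k (\<lambda>i. \<Phi> i ^^ s i) R) has_sum X) ({1..k} \<rightarrow>\<^sub>E UNIV) \<and>
      positive_op X \<and> multi_defect k \<Phi> m X = R \<and>
      (\<forall>X'. positive_op X' \<and> multi_defect k \<Phi> m X' = R \<longrightarrow> X' = X) \<and> invertible_op X \<and>
      (\<forall>p. multi_le k p m \<longrightarrow> positive_op (multi_defect k \<Phi> p X))"
    if "decay" and R: "positive_op R" "invertible_op R" for R
  proof -
    interpret decaying_maps k \<Phi> using decaying[OF \<open>decay\<close>] .
    have pos: "positive_op (multi_defect k \<Phi> p (solution m R))" if "multi_le k p m" for p
      by (rule multi_defect_solution_positive[OF R(1) that])
    have inv: "invertible_op (multi_defect k \<Phi> m (solution m R))"
      by (simp add: multi_defect_solution_self R)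
    show ?thesis
    proof (intro exI conjI allI impI)
      show "((\<lambda>s. real (\<Prod>i=1..k. (s i + m i - 1) choose (m i - 1)) *\<^sub>R
        comp_upto k (\<lambda>i. \<Phi> i ^^ s i) R) has_sum solution m R) ({1..k} \<rightarrow>\<^sub>E UNIV)"
        using n_m by (intro solution_has_sum) blast
      show "positive_op (solution m R)"
        by (rule multi_defect_invertible(1)[of m, OF _ inv]) (rule pos)
      \<comment> \<open>The solution is its own defect of order 0, hence lies above its defect of
        order m, which is the invertible R.\<close>
      show "invertible_op (solution m R)"
        by (rule multi_defect_invertible(2)[of m, OF _ inv]) (rule pos)
      show "multi_defect k \<Phi> m (solution m R) = R" by (rule multi_defect_solution_self)
      show "X' = solution m R" if "positive_op X' \<and> multi_defect k \<Phi> m X' = R" for X'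
        by (rule multi_defect_unique[of m]) (simp add: that multi_defect_solution_self)
    qed (rule pos)
  qed
  have stmt5_if: "stmt5" if "decay"
  proof -
    have "\<forall>i\<in>{1..k}. power_bounded (\<Phi> i) \<and> pure (\<Phi> i)"
      using that power_bounded_pure_if_decay[OF dom] unfolding decay_def by blast
    \<comment> \<open>The identity serves as the right-hand side R in (v).\<close>
    moreover have "invertible_op (1 :: 'h bop)" by (rule invertible_opI[of 1]) simp_all
    ultimately show ?thesis
      unfolding stmt5_def using solution[OF that positive_op_one] positive_op_one by blast
  qed
  \<comment> \<open>X becomes Q: its top defect is R, which is positive and invertible.\<close>
  have stmt2_if: "stmt2" if "stmt5"
    using that unfolding stmt5_def stmt2_def strictly_positive_op_def by metis
  have equiv: "(stmt1 \<longleftrightarrow> stmt2) \<and> (stmt2 \<longleftrightarrow> stmt3) \<and> (stmt3 \<longleftrightarrow> stmt4) \<and> (stmt4 \<longleftrightarrow> stmt5)"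
    using eq12 eq3 eq4 decay_if_2 stmt5_if stmt2_if by blast
  moreover have "stmt1 \<longrightarrow> (\<forall>R. positive_op R \<and> invertible_op R \<longrightarrow>
      (\<exists>X. ((\<lambda>s. real (\<Prod>i=1..k. (s i + m i - 1) choose (m i - 1)) *\<^sub>R
          comp_upto k (\<lambda>i. \<Phi> i ^^ s i) R) has_sum X) ({1..k} \<rightarrow>\<^sub>E UNIV) \<and>
        positive_op X \<and> multi_defect k \<Phi> m X = R \<and>
        (\<forall>X'. positive_op X' \<and> multi_defect k \<Phi> m X' = R \<longrightarrow> X' = X) \<and> invertible_op X))"
    using eq12 decay_if_2 solution by blast
  ultimately show ?thesis
    unfolding Let_def Delta stmt1_def stmt2_def stmt3_def stmt4_def stmt5_def
    unfolding \<Phi>_def by (simp only: conj_assoc)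
qed

end
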